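(* Let $n\ge 2$ be even. Consider the family of curves in $Q/\mathbb Z_n$ whose members are the images under $\Phi$ of all $(1,1)$-curves on $Q$ of the form $$\zeta\eta+a\zeta-\bar a\eta+b=0,\qquad a\in\mathbb C,\ b\in\mathbb R,\ |a|^2+b<0.$$ Each member of this family is real, and these curves constitute a family of minitwistor lines on $Q/\mathbb Z_n$ in the sense that they determine an Einstein–Weyl orbifold isomorphic to the hyperbolic orbifold $\mathbb B/\mathbb Z_n$.
   Context: $Q=\mathbb P^1\times\mathbb P^1$ with affine coordinates $(\zeta,\eta)$ and real structure $\sigma(\zeta,\eta)=(\bar\eta,\bar\zeta)$. $\mathbb Z_n$ acts on $Q$, generated by $R(\zeta,\eta)=(e^{2\pi i/n}\zeta,e^{-2\pi i/n}\eta)$; $\Phi:Q\to Q/\mathbb Z_n$ is the quotient map, and $Q/\mathbb Z_n$ carries the induced real structure. A curve is real if it is invariant under the real structure. Hitchin correspondence: a three-parameter real family of minitwistor lines (smooth rational curves with self-intersection number $2$, or, for nodal curves in $Q/\mathbb Z_n$, rational curves whose lifts to $Q$ are such curves) determines an Einstein–Weyl structure on its parameter space. The standard real minitwistor lines on $Q$ are the curves $\zeta\eta+a\zeta+\bar a\eta+b=0$ with $a\in\mathbb C$, $b\in\mathbb R$, $|a|^2<b$; their parameter space $\{(a,b)\in\mathbb C\times\mathbb R:|a|^2<b\}$ with the induced Einstein–Weyl structure is hyperbolic 3-space $\mathbb B$ (paraboloid model). $R$ acts on it by $(a,b)\mapsto(e^{-2\pi i/n}a,b)$, i.e. as the rotation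 of order $n$ about the geodesic $a=0$, and $\mathbb B/\mathbb Z_n$ is the quotient hyperbolic orbifold; it is the Einstein–Weyl orbifold determined by the images under $\Phi$ of the standard minitwistor lines. *)

theory Defs
  imports "HOL-Analysis.Analysis"
begin

section \<open>The quadric and its quotient\<close>

text \<open>A point of the projective line is the set of all its homogeneous coordinate vectors; the
  affine coordinate of the class of \<open>z\<close> is \<open>z $ 1 / z $ 2\<close>.\<close>

definition hpt :: "complex^2 \<Rightarrow> (complex^2) set" where
  "hpt z = {c *s z | c. c \<noteq> 0}"

definition P1 :: "(complex^2) set set" where
  "P1 = {hpt z | z. z \<noteq> 0}"

type_synonym qpoint = "(complex^2) set \<times> (complex^2) set"

definition Q :: "qpoint set" where
  "Q = P1 \<times> P1"

text \<open>In affine coordinates: \<open>(\<zeta>, \<eta>) \<mapsto> (cnj \<eta>, cnj \<zeta>)\<close>.\<close>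

definition sigma :: "qpoint \<Rightarrow> qpoint" where
  "sigma x = ((\<lambda>w. \<chi> i. cnj (w $ i)) ` snd x, (\<lambda>z. \<chi> i. cnj (z $ i)) ` fst x)"

text \<open>In affine coordinates: \<open>(\<zeta>, \<eta>) \<mapsto> (exp (2 \<pi> i / n) \<zeta>, exp (- 2 \<pi> i / n) \<eta>)\<close>.\<close>

definition Rot :: "nat \<Rightarrow> qpoint \<Rightarrow> qpoint" where
  "Rot n x = ((\<lambda>z. vector [cis (2 * pi / real n) * z $ 1, z $ 2]) ` fst x,
              (\<lambda>w. vector [cis (- 2 * pi / real n) * w $ 1, w $ 2]) ` snd x)"

text \<open>Points of the quotient \<open>Q / Z_n\<close> are the orbits.\<close>

definition Phi :: "nat \<Rightarrow> qpoint \<Rightarrow> qpoint set" where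
  "Phi n x = {(Rot n ^^ k) x | k. True}"

definition sigma_quot :: "qpoint set \<Rightarrow> qpoint set" where
  "sigma_quot orb = sigma ` orb"

definition real_curve :: "qpoint set set \<Rightarrow> bool" where
  "real_curve D \<longleftrightarrow> sigma_quot ` D = D"

section \<open>Curves and minitwistor lines\<close>

definition ev :: "complex^2^2 \<Rightarrow> complex^2 \<Rightarrow> complex^2 \<Rightarrow> complex" where
  "ev F z w = (\<Sum>i\<in>UNIV. \<Sum>j\<in>UNIV. F $ i $ j * z $ i * w $ j)"

definition curve :: "complex^2^2 \<Rightarrow> qpoint set" where
  "curve F = {(hpt z, hpt w) | z w. z \<noteq> 0 \<and> w \<noteq> 0 \<and> ev F z w = 0}"

text \<open>The form whose affine equation is \<open>\<zeta> \<eta> + a \<zeta> + c \<eta> + b = 0\<close>.\<close>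

definition form11 :: "complex \<Rightarrow> complex \<Rightarrow> complex \<Rightarrow> complex^2^2" where
  "form11 a c b = vector [vector [1, a], vector [c, b]]"

text \<open>Homogeneous coordinates of a holomorphic map of degree \<open>d\<close> from the projective line
  to itself.\<close>

definition hom_map :: "nat \<Rightarrow> (complex^2 \<Rightarrow> complex^2) \<Rightarrow> bool" where
  "hom_map d A \<longleftrightarrow>
     (\<exists>c :: nat \<Rightarrow> complex^2. \<forall>z. A z = (\<Sum>i\<le>d. (z $ 1 ^ i * z $ 2 ^ (d - i)) *s c i)) \<and>
     (\<forall>z. z \<noteq> 0 \<longrightarrow> A z \<noteq> 0)"

definition wedge :: "complex^2 \<Rightarrow> complex^2 \<Rightarrow> complex" where
  "wedge u v = u $ 1 * v $ 2 - u $ 2 * v $ 1"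

text \<open>\<open>C\<close> is the image of a holomorphic embedding (injective immersion) of the projective line
  whose two components have degrees \<open>d\<close> and \<open>e\<close>. The tangent space at the class of \<open>z\<close> is
  the plane modulo \<open>z\<close>, so the induced map given by \<open>A\<close> is immersive there iff \<open>A z\<close> and the
  derivative of \<open>A\<close> in a transversal direction \<open>w\<close> are independent.\<close>

definition smooth_rational_curve :: "nat \<Rightarrow> nat \<Rightarrow> qpoint set \<Rightarrow> bool" where
  "smooth_rational_curve d e C \<longleftrightarrow> (\<exists>A B. hom_map d A \<and> hom_map e B \<and>
     C = {(hpt (A z), hpt (B z)) | z. z \<noteq> 0} \<and>
     (\<forall>z w. z \<noteq> 0 \<longrightarrow> w \<noteq> 0 \<longrightarrow> hpt (A z) = hpt (A w) \<longrightarrow> hpt (B z) = hpt (B w) \<longrightarrow> hpt z = hpt w) \<and>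
     (\<forall>z w. z \<noteq> 0 \<longrightarrow> wedge z w \<noteq> 0 \<longrightarrow>
        wedge (A z) (frechet_derivative A (at z) w) \<noteq> 0 \<or>
        wedge (B z) (frechet_derivative B (at z) w) \<noteq> 0))"

text \<open>The image meets the two rulings in \<open>d\<close> and \<open>e\<close> points, and the intersection form on
  \<open>Q\<close> is \<open>(d, e) . (d', e') = d e' + d' e\<close>; hence the self-intersection number \<open>2 d e\<close>.\<close>

definition minitwistor_line :: "qpoint set \<Rightarrow> bool" where
  "minitwistor_line C \<longleftrightarrow> (\<exists>d e. smooth_rational_curve d e C \<and> d * e + d * e = 2)"

section \<open>Einstein--Weyl structures in coordinates\<close>

primrec ck_on :: "nat \<Rightarrow> ('a::real_normed_vector \<Rightarrow> 'b::real_normed_vector) \<Rightarrow> 'a set \<Rightarrow> bool" where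
  "ck_on 0 f U \<longleftrightarrow> continuous_on U f"
| "ck_on (Suc k) f U \<longleftrightarrow> (\<forall>x\<in>U. f differentiable (at x)) \<and>
     (\<forall>v. ck_on k (\<lambda>x. frechet_derivative f (at x) v) U)"

definition smooth_map_on :: "('a::real_normed_vector \<Rightarrow> 'b::real_normed_vector) \<Rightarrow> 'a set \<Rightarrow> bool" where
  "smooth_map_on f U \<longleftrightarrow> (\<forall>k. ck_on k f U)"

text \<open>The model three-space, with coordinates \<open>(a, b)\<close>.\<close>

type_synonym E3 = "complex \<times> real"
type_synonym metric3 = "E3 \<Rightarrow> E3 \<Rightarrow> E3 \<Rightarrow> real"
type_synonym conn3 = "E3 \<Rightarrow> E3 \<Rightarrow> E3 \<Rightarrow> E3"

definition metric_on :: "E3 set \<Rightarrow> metric3 \<Rightarrow> bool" where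
  "metric_on U g \<longleftrightarrow>
     (\<forall>x\<in>U. bilinear (g x) \<and> (\<forall>v w. g x v w = g x w v) \<and> (\<forall>v. v \<noteq> 0 \<longrightarrow> g x v v > 0)) \<and>
     (\<forall>v w. smooth_map_on (\<lambda>x. g x v w) U)"

text \<open>Torsion-free affine connections, given by their Christoffel symbols:
  the covariant derivative is \<open>D\<^sub>u Y = dY(u) + \<Gamma>(u, Y)\<close>.\<close>

definition connection_on :: "E3 set \<Rightarrow> conn3 \<Rightarrow> bool" where
  "connection_on U \<Gamma> \<longleftrightarrow>
     (\<forall>x\<in>U. bilinear (\<Gamma> x) \<and> (\<forall>v w. \<Gamma> x v w = \<Gamma> x w v)) \<and>
     (\<forall>v w. smooth_map_on (\<lambda>x. \<Gamma> x v w) U)"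

definition cov_metric :: "metric3 \<Rightarrow> conn3 \<Rightarrow> E3 \<Rightarrow> E3 \<Rightarrow> E3 \<Rightarrow> E3 \<Rightarrow> real" where
  "cov_metric g \<Gamma> x u v w =
     frechet_derivative (\<lambda>y. g y v w) (at x) u - g x (\<Gamma> x u v) w - g x v (\<Gamma> x u w)"

definition curvature :: "conn3 \<Rightarrow> E3 \<Rightarrow> E3 \<Rightarrow> E3 \<Rightarrow> E3 \<Rightarrow> E3" where
  "curvature \<Gamma> x u v w =
     frechet_derivative (\<lambda>y. \<Gamma> y v w) (at x) u - frechet_derivative (\<lambda>y. \<Gamma> y u w) (at x) v
     + \<Gamma> x u (\<Gamma> x v w) - \<Gamma> x v (\<Gamma> x u w)"

definition ricci :: "conn3 \<Rightarrow> E3 \<Rightarrow> E3 \<Rightarrow> E3 \<Rightarrow> real" where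
  "ricci \<Gamma> x v w = (\<Sum>e\<in>Basis. curvature \<Gamma> x e v w \<bullet> e)"

text \<open>An Einstein--Weyl structure is represented by a metric \<open>g\<close> in the conformal class and
  the Weyl connection; \<open>same_EW\<close> identifies representatives differing by a conformal factor.\<close>

definition einstein_weyl :: "E3 set \<Rightarrow> metric3 \<Rightarrow> conn3 \<Rightarrow> bool" where
  "einstein_weyl U g \<Gamma> \<longleftrightarrow> metric_on U g \<and> connection_on U \<Gamma> \<and>
     (\<exists>\<omega>. \<forall>x\<in>U. \<forall>u v w. cov_metric g \<Gamma> x u v w = \<omega> x u * g x v w) \<and>
     (\<exists>\<Lambda>. \<forall>x\<in>U. \<forall>v w. ricci \<Gamma> x v w + ricci \<Gamma> x w v = \<Lambda> x * g x v w)"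

definition same_EW :: "E3 set \<Rightarrow> metric3 \<Rightarrow> conn3 \<Rightarrow> metric3 \<Rightarrow> conn3 \<Rightarrow> bool" where
  "same_EW U g \<Gamma> g' \<Gamma>' \<longleftrightarrow>
     (\<forall>x\<in>U. (\<exists>c>0. \<forall>v w. g' x v w = c * g x v w) \<and> (\<forall>v w. \<Gamma>' x v w = \<Gamma> x v w))"

text \<open>\<open>\<lambda>\<close> is a local diffeomorphism from \<open>V\<close> pulling back \<open>([g'], \<Gamma>')\<close> to \<open>([g], \<Gamma>)\<close>.\<close>

definition local_EW_iso :: "E3 set \<Rightarrow> metric3 \<Rightarrow> conn3 \<Rightarrow> metric3 \<Rightarrow> conn3 \<Rightarrow> (E3 \<Rightarrow> E3) \<Rightarrow> bool" where
  "local_EW_iso V g \<Gamma> g' \<Gamma>' l \<longleftrightarrow> smooth_map_on l V \<and>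
     (\<forall>x\<in>V. let L = frechet_derivative l (at x) in
        bij L \<and>
        (\<exists>c>0. \<forall>v w. g' (l x) (L v) (L w) = c * g x v w) \<and>
        (\<forall>v w. L (\<Gamma> x v w) =
           frechet_derivative (\<lambda>y. frechet_derivative l (at y) w) (at x) v + \<Gamma>' (l x) (L v) (L w)))"

section \<open>Einstein--Weyl orbifolds\<close>

record 'p ew_chart =
  ec_dom :: "E3 set"
  ec_grp :: "(E3 \<Rightarrow> E3) set"
  ec_map :: "E3 \<Rightarrow> 'p"
  ec_met :: metric3
  ec_conn :: conn3

text \<open>Elements of the group of a chart only matter through their restrictions to its domain.\<close>

definition is_ew_chart :: "'p ew_chart \<Rightarrow> bool" where
  "is_ew_chart c \<longleftrightarrow> (let U = ec_dom c; G = ec_grp c; p = ec_map c; g = ec_met c; \<Gamma> = ec_conn c in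
     open U \<and> connected U \<and> U \<noteq> {} \<and> einstein_weyl U g \<Gamma> \<and>
     finite G \<and> (\<exists>\<epsilon>\<in>G. \<forall>x\<in>U. \<epsilon> x = x) \<and>
     (\<forall>\<gamma>\<in>G. \<forall>\<delta>\<in>G. \<exists>\<epsilon>\<in>G. \<forall>x\<in>U. \<epsilon> x = \<gamma> (\<delta> x)) \<and>
     (\<forall>\<gamma>\<in>G. \<exists>\<delta>\<in>G. \<forall>x\<in>U. \<delta> (\<gamma> x) = x) \<and>
     (\<forall>\<gamma>\<in>G. bij_betw \<gamma> U U \<and> local_EW_iso U g \<Gamma> g \<Gamma> \<gamma>) \<and>
     (\<forall>x\<in>U. \<forall>y\<in>U. p x = p y \<longleftrightarrow> (\<exists>\<gamma>\<in>G. y = \<gamma> x)))"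

text \<open>Near \<open>x\<close>, the map \<open>h\<close> of underlying spaces lifts to a local Einstein--Weyl isomorphism
  of charts taking \<open>x\<close> to \<open>y\<close>.\<close>

definition lifts_at :: "'p ew_chart \<Rightarrow> 'q ew_chart \<Rightarrow> ('p \<Rightarrow> 'q) \<Rightarrow> E3 \<Rightarrow> E3 \<Rightarrow> bool" where
  "lifts_at c d h x y \<longleftrightarrow> (\<exists>V l. open V \<and> x \<in> V \<and> V \<subseteq> ec_dom c \<and> l ` V \<subseteq> ec_dom d \<and> l x = y \<and>
     local_EW_iso V (ec_met c) (ec_conn c) (ec_met d) (ec_conn d) l \<and>
     (\<forall>v\<in>V. ec_map d (l v) = h (ec_map c v)))"

definition orbifold_topology :: "'p set \<Rightarrow> 'p ew_chart set \<Rightarrow> 'p topology" where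
  "orbifold_topology X A =
     topology (\<lambda>W. W \<subseteq> X \<and> (\<forall>c\<in>A. open {x \<in> ec_dom c. ec_map c x \<in> W}))"

definition ew_orbifold :: "'p set \<Rightarrow> 'p ew_chart set \<Rightarrow> bool" where
  "ew_orbifold X A \<longleftrightarrow> (\<forall>c\<in>A. is_ew_chart c) \<and> (\<Union>c\<in>A. ec_map c ` ec_dom c) = X \<and>
     (\<forall>c\<in>A. \<forall>d\<in>A. \<forall>x\<in>ec_dom c. \<forall>y\<in>ec_dom d. ec_map c x = ec_map d y \<longrightarrow> lifts_at c d id x y) \<and>
     Hausdorff_space (orbifold_topology X A) \<and> second_countable (orbifold_topology X A)"

text \<open>Any two points over corresponding points of the underlying spaces are related by a lift, so
  the lifts intertwine the local isotropy groups and, \<open>h\<close> being bijective, its inverse lifts too.\<close>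

definition ew_orbifold_isomorphic ::
    "'p set \<Rightarrow> 'p ew_chart set \<Rightarrow> 'q set \<Rightarrow> 'q ew_chart set \<Rightarrow> bool" where
  "ew_orbifold_isomorphic X A Y B \<longleftrightarrow> (\<exists>h. bij_betw h X Y \<and>
     (\<forall>c\<in>A. \<forall>d\<in>B. \<forall>x\<in>ec_dom c. \<forall>y\<in>ec_dom d.
        h (ec_map c x) = ec_map d y \<longrightarrow> lifts_at c d h x y))"

section \<open>The Hitchin correspondence\<close>

text \<open>A family of minitwistor lines is given by defining forms \<open>f x\<close>, \<open>x \<in> U\<close>. The complexified
  tangent vector \<open>v + i w\<close> corresponds to the section of the normal bundle of \<open>curve (f x)\<close>
  induced by the following form, restricted to the curve.\<close>

definition normal_section :: "(E3 \<Rightarrow> complex^2^2) \<Rightarrow> E3 \<Rightarrow> E3 \<Rightarrow> E3 \<Rightarrow> complex^2^2" where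
  "normal_section f x v w =
     (\<chi> i j. frechet_derivative f (at x) v $ i $ j + \<i> * frechet_derivative f (at x) w $ i $ j)"

text \<open>\<open>S\<close>, restricted to the curve defined by \<open>F\<close>, vanishes at some point to order at least two;
  the second line is vanishing of its derivative along the tangent line of the curve.\<close>

definition has_double_zero :: "complex^2^2 \<Rightarrow> complex^2^2 \<Rightarrow> bool" where
  "has_double_zero F S \<longleftrightarrow> (\<exists>z w. z \<noteq> 0 \<and> w \<noteq> 0 \<and> ev F z w = 0 \<and> ev S z w = 0 \<and>
     (\<forall>z' w'. ev F z' w + ev F z w' = 0 \<longrightarrow> ev S z' w + ev S z w' = 0))"

text \<open>The Kodaira map to the (three-dimensional) space of normal sections is injective, hence
  an isomorphism, on the complexified tangent space.\<close>

definition complete_family :: "E3 set \<Rightarrow> (E3 \<Rightarrow> complex^2^2) \<Rightarrow> bool" where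
  "complete_family U f \<longleftrightarrow> smooth_map_on f U \<and> (\<forall>x\<in>U. minitwistor_line (curve (f x))) \<and>
     (\<forall>x\<in>U. \<forall>v w. curve (f x) \<subseteq> curve (normal_section f x v w) \<longrightarrow> v = 0 \<and> w = 0)"

text \<open>The complexified vector \<open>v + i w\<close> is null iff \<open>g(v, v) - g(w, w) + 2 i g(v, w) = 0\<close>.\<close>

definition hitchin_null :: "E3 set \<Rightarrow> (E3 \<Rightarrow> complex^2^2) \<Rightarrow> metric3 \<Rightarrow> bool" where
  "hitchin_null U f g \<longleftrightarrow> (\<forall>x\<in>U. \<forall>v w.
     (g x v v = g x w w \<and> g x v w = 0) \<longleftrightarrow> has_double_zero (f x) (normal_section f x v w))"

text \<open>The (unparametrised) geodesics are the families of lines through two fixed distinct points.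
  Lines through a point with a fixed tangent give null geodesics, of which there are no real
  ones since the metric is definite.\<close>

definition hitchin_geodesic :: "E3 set \<Rightarrow> (E3 \<Rightarrow> complex^2^2) \<Rightarrow> conn3 \<Rightarrow> bool" where
  "hitchin_geodesic U f \<Gamma> \<longleftrightarrow> (\<forall>(l::real) r \<gamma> \<gamma>' \<gamma>''. l < r \<longrightarrow>
     (\<forall>t\<in>{l<..<r}. \<gamma> t \<in> U \<and> (\<gamma> has_vector_derivative \<gamma>' t) (at t) \<and>
        (\<gamma>' has_vector_derivative \<gamma>'' t) (at t) \<and> \<gamma>' t \<noteq> 0) \<longrightarrow>
     ((\<forall>t\<in>{l<..<r}. \<exists>k. \<gamma>'' t + \<Gamma> (\<gamma> t) (\<gamma>' t) (\<gamma>' t) = k *\<^sub>R \<gamma>' t) \<longleftrightarrow>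
      (\<exists>p\<in>Q. \<exists>q\<in>Q. p \<noteq> q \<and> (\<forall>t\<in>{l<..<r}. p \<in> curve (f (\<gamma> t)) \<and> q \<in> curve (f (\<gamma> t))))))"

definition determines_EW :: "E3 set \<Rightarrow> (E3 \<Rightarrow> complex^2^2) \<Rightarrow> metric3 \<Rightarrow> conn3 \<Rightarrow> bool" where
  "determines_EW U f g \<Gamma> \<longleftrightarrow> complete_family U f \<and>
     einstein_weyl U g \<Gamma> \<and> hitchin_null U f g \<and> hitchin_geodesic U f \<Gamma> \<and>
     (\<forall>g' \<Gamma>'. einstein_weyl U g' \<Gamma>' \<and> hitchin_null U f g' \<and> hitchin_geodesic U f \<Gamma>' \<longrightarrow>
        same_EW U g \<Gamma> g' \<Gamma>')"

text \<open>The points of the orbifold determined by a family \<open>X\<close> of real curves on \<open>Q / Z_n\<close> are the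
  curves themselves, and its charts are families of lifts to \<open>Q\<close>.\<close>

definition determines_EW_orbifold :: "nat \<Rightarrow> qpoint set set set \<Rightarrow> qpoint set set ew_chart set \<Rightarrow> bool" where
  "determines_EW_orbifold n X A \<longleftrightarrow> ew_orbifold X A \<and> (\<forall>D\<in>X. real_curve D) \<and>
     (\<forall>c\<in>A. \<exists>f. determines_EW (ec_dom c) f (ec_met c) (ec_conn c) \<and>
        (\<forall>x\<in>ec_dom c. ec_map c x = Phi n ` curve (f x)))"

section \<open>The hyperbolic orbifold\<close>

definition paraboloid :: "E3 set" where
  "paraboloid = {(a, b). (cmod a)\<^sup>2 < b}"

text \<open>With \<open>r\<^sup>2 = u\<close> this is the metric \<open>(|da|\<^sup>2 + dr\<^sup>2) / r\<^sup>2\<close> of the upper half-space,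
  as shown below.\<close>

definition hyp_metric :: metric3 where
  "hyp_metric x v w = (let u = snd x - (cmod (fst x))\<^sup>2 in
     ((snd v - 2 * (fst x \<bullet> fst v)) * (snd w - 2 * (fst x \<bullet> fst w)) + 4 * u * (fst v \<bullet> fst w))
       / (4 * u\<^sup>2))"

lemma hyp_metric_upper_half_space:
  fixes a :: complex and r :: real and v w :: E3
  assumes "r > 0"
  defines "\<psi> \<equiv> \<lambda>x :: E3. (fst x, (snd x)\<^sup>2 + (cmod (fst x))\<^sup>2)"
  defines "L \<equiv> \<lambda>v :: E3. (fst v, 2 * r * snd v + 2 * (a \<bullet> fst v))"
  shows "(\<psi> has_derivative L) (at (a, r))"
    and "hyp_metric (\<psi> (a, r)) (L v) (L w) = (fst v \<bullet> fst w + snd v * snd w) / r\<^sup>2"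
proof -
  have "(\<psi> has_derivative (\<lambda>v. (fst v, 2 * r * snd v + (a \<bullet> fst v + fst v \<bullet> a)))) (at (a, r))"
    unfolding \<psi>_def power2_norm_eq_inner
    by (auto intro!: derivative_eq_intros simp: algebra_simps)
  then show "(\<psi> has_derivative L) (at (a, r))"
    by (simp add: L_def inner_commute)
  show "hyp_metric (\<psi> (a, r)) (L v) (L w) = (fst v \<bullet> fst w + snd v * snd w) / r\<^sup>2"
    using assms(1) by (simp add: hyp_metric_def \<psi>_def L_def Let_def field_simps power2_eq_square)
qed

definition levi_civita :: "metric3 \<Rightarrow> conn3" where
  "levi_civita g x = (THE G. bilinear G \<and> (\<forall>u v. G u v = G v u) \<and>
     (\<forall>u v w. frechet_derivative (\<lambda>y. g y v w) (at x) u = g x (G u v) w + g x v (G u w)))"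

definition hyp_rot :: "nat \<Rightarrow> E3 \<Rightarrow> E3" where
  "hyp_rot n x = (cis (- 2 * pi / real n) * fst x, snd x)"

definition hyp_orbit :: "nat \<Rightarrow> E3 \<Rightarrow> E3 set" where
  "hyp_orbit n x = {(hyp_rot n ^^ k) x | k. True}"

definition hyp_orbifold :: "nat \<Rightarrow> E3 set set" where
  "hyp_orbifold n = hyp_orbit n ` paraboloid"

definition hyp_atlas :: "nat \<Rightarrow> E3 set ew_chart set" where
  "hyp_atlas n = {\<lparr> ec_dom = paraboloid, ec_grp = {hyp_rot n ^^ k | k. k < n},
      ec_map = hyp_orbit n, ec_met = hyp_metric, ec_conn = levi_civita hyp_metric \<rparr>}"

end

theory Submission
  imports Defs
begin

text \<open>The substitution \<open>\<eta> \<mapsto> - \<eta>\<close> commutes with the rotations and carries the family to the standard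
  minitwistor lines, so its parameter space is the paraboloid. It is not compatible with \<open>\<sigma>\<close>, which becomes
  \<open>\<sigma> \<circ> R\<^sup>m\<close> with \<open>m = n / 2\<close>; since \<open>R\<^sup>m\<close> acts trivially on the quotient, the image curves are still
  real there. Restricting normal sections to a line yields a binary quadratic form whose discriminant is a
  multiple of the hyperbolic metric, and two points of the quadric cut out a straight segment in the coordinates
  \<open>(a, b)\<close>, i.e. a hyperbolic geodesic; a Weyl connection is determined by its conformal class and its
  geodesics. Distinct lines share at most two points, hence two lines have the same image in the quotient iff a
  power of the rotation maps one to the other.\<close>

section \<open>Smooth maps\<close>

text \<open>The Einstein--Weyl data see only the lifts to \<open>Q\<close>: null cone and geodesics
  come from the complex lines and their real parameters, and \<open>sigma\<close> enters only
  through the realness of the images. Hence one global chart with the whole cyclic group suffices,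
  and the isomorphism is induced by the identity on parameters. The coordinates (a, b) are
  convenient because incidence with a point is affine in them. Geodesics become straight segments,
  and the connection differs from the flat one by a term \<open>\<phi>(v) w + \<phi>(w) v\<close>.
  Two definitions shape the proof. \<open>hitchin_geodesic\<close> tests arbitrary twice
  differentiable curves with a factor k given only pointwise, so k cannot simply be integrated to
  reparametrise. \<open>levi_civita\<close> is a definite description, so the explicit connection is
  identified with it only at points of the paraboloid, and comparisons of charts must allow for
  this.\<close>

lemma frechet_derivative_eq: "(f has_derivative f') (at x) \<Longrightarrow> frechet_derivative f (at x) = f'"
  by (metis frechet_derivative_at)

text \<open>\<open>ck_on\<close> iterates \<open>frechet_derivative\<close> as a function on the
  whole space, while formulas for it are known on U only. Since U is open, derivatives at its points
  see only values in U, so such formulas may be substituted.\<close>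

lemma ck_on_cong:
  assumes "open U" "\<And>x. x \<in> U \<Longrightarrow> f x = g x"
  shows "ck_on k f U \<longleftrightarrow> ck_on k g U"
  using assms(2)
proof (induction k arbitrary: f g)
  case 0
  then show ?case by (simp cong: continuous_on_cong)
next
  case (Suc k)
  have D: "(f has_derivative D) (at x) \<longleftrightarrow> (g has_derivative D) (at x)" if "x \<in> U" for x D
    using has_derivative_transform_within_open[OF _ assms(1) that, of f D UNIV g]
      has_derivative_transform_within_open[OF _ assms(1) that, of g D UNIV f] Suc.prems by auto
  have "f differentiable (at x) \<longleftrightarrow> g differentiable (at x)" if "x \<in> U" for x
    unfolding differentiable_def by (simp only: D[OF that])
  moreover have "frechet_derivative f (at x) v = frechet_derivative g (at x) v" if "x \<in> U" for x v
    unfolding frechet_derivative_def by (simp only: D[OF that])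
  then have "ck_on k (\<lambda>x. frechet_derivative f (at x) v) U \<longleftrightarrow> ck_on k (\<lambda>x. frechet_derivative g (at x) v) U" for v
    by (rule Suc.IH)
  ultimately show ?case by auto
qed

lemma ck_on_Suc_imp: "ck_on (Suc k) f U \<Longrightarrow> ck_on k f U"
proof (induction k arbitrary: f)
  case 0
  then show ?case
    by (auto intro!: continuous_at_imp_continuous_on differentiable_imp_continuous_within)
next
  case (Suc k)
  have "\<forall>v. ck_on (Suc k) (\<lambda>x. frechet_derivative f (at x) v) U"
    using Suc.prems by (subst (asm) ck_on.simps) blast
  moreover have "\<forall>x\<in>U. f differentiable (at x)"
    using Suc.prems by (subst (asm) ck_on.simps) blast
  ultimately show ?case using Suc.IH by auto
qed

lemma ck_on_SucI:
  assumes "open U" "\<And>x. x \<in> U \<Longrightarrow> (f has_derivative f' x) (at x)"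
    "\<And>v. ck_on k (\<lambda>x. f' x v) U"
  shows "ck_on (Suc k) f U"
proof -
  have "ck_on k (\<lambda>x. frechet_derivative f (at x) v) U" for v
    using assms(3)[of v] by (subst ck_on_cong[OF assms(1)]) (auto simp: frechet_derivative_eq[OF assms(2)])
  then show ?thesis using assms(2) by (auto simp: differentiable_def)
qed

lemma ck_on_SucD:
  assumes "ck_on (Suc k) f U"
  shows "x \<in> U \<Longrightarrow> (f has_derivative frechet_derivative f (at x)) (at x)"
    "ck_on k (\<lambda>x. frechet_derivative f (at x) v) U"
  using assms by (auto simp: frechet_derivative_works)

lemma ck_on_const: "ck_on k (\<lambda>x. c) U"
  by (induction k arbitrary: c) (auto simp: frechet_derivative_const)

lemma ck_on_add:
  assumes "open U" shows "ck_on k f U \<Longrightarrow> ck_on k g U \<Longrightarrow> ck_on k (\<lambda>x. f x + g x) U"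
proof (induction k arbitrary: f g)
  case (Suc k)
  show ?case
  proof (rule ck_on_SucI[OF assms])
    show "((\<lambda>x. f x + g x) has_derivative
        (\<lambda>v. frechet_derivative f (at x) v + frechet_derivative g (at x) v)) (at x)" if "x \<in> U" for x
      by (rule has_derivative_add[OF ck_on_SucD(1)[OF Suc.prems(1) that] ck_on_SucD(1)[OF Suc.prems(2) that]])
    show "ck_on k (\<lambda>x. frechet_derivative f (at x) v + frechet_derivative g (at x) v) U" for v
      by (intro Suc.IH ck_on_SucD(2)[OF Suc.prems(1)] ck_on_SucD(2)[OF Suc.prems(2)])
  qed
qed (simp add: continuous_on_add)

lemma ck_on_bilinear:
  assumes "open U" "bounded_bilinear bm"
  shows "ck_on k f U \<Longrightarrow> ck_on k g U \<Longrightarrow> ck_on k (\<lambda>x. bm (f x) (g x)) U"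
proof (induction k arbitrary: f g)
  case 0
  then show ?case using bounded_bilinear.continuous_on[OF assms(2)] by auto
next
  case (Suc k)
  show ?case
  proof (rule ck_on_SucI[OF assms(1)])
    show "((\<lambda>x. bm (f x) (g x)) has_derivative (\<lambda>v. bm (f x) (frechet_derivative g (at x) v)
        + bm (frechet_derivative f (at x) v) (g x))) (at x)" if "x \<in> U" for x
      by (rule bounded_bilinear.FDERIV[OF assms(2) ck_on_SucD(1)[OF Suc.prems(1) that] ck_on_SucD(1)[OF Suc.prems(2) that]])
    show "ck_on k (\<lambda>x. bm (f x) (frechet_derivative g (at x) v) + bm (frechet_derivative f (at x) v) (g x)) U" for v
      by (intro ck_on_add[OF assms(1)] Suc.IH ck_on_SucD(2)[OF Suc.prems(1)] ck_on_SucD(2)[OF Suc.prems(2)]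
          ck_on_Suc_imp[OF Suc.prems(1)] ck_on_Suc_imp[OF Suc.prems(2)])
  qed
qed

lemmas ck_on_mult = ck_on_bilinear[OF _ bounded_bilinear_mult]
lemmas ck_on_scaleR = ck_on_bilinear[OF _ bounded_bilinear_scaleR]

lemma ck_on_inverse:
  fixes f :: "'a::real_normed_vector \<Rightarrow> real"
  assumes "open U" "\<And>x. x \<in> U \<Longrightarrow> f x \<noteq> 0"
  shows "ck_on k f U \<Longrightarrow> ck_on k (\<lambda>x. inverse (f x)) U"
proof (induction k)
  case 0
  then show ?case using assms(2) by (auto intro: continuous_on_inverse)
next
  case (Suc k)
  show ?case
  proof (rule ck_on_SucI[OF assms(1)])
    \<comment> \<open>The derivative is arranged as a product containing
      \<open>inverse (f x)\<close> itself, so that the induction hypothesis applies to it.\<close>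
    show "((\<lambda>x. inverse (f x)) has_derivative
        (\<lambda>v. (-1) * (inverse (f x) * (frechet_derivative f (at x) v * inverse (f x))))) (at x)" if "x \<in> U" for x
      using Deriv.has_derivative_inverse[OF assms(2)[OF that] ck_on_SucD(1)[OF Suc.prems that]]
      by (simp add: mult.assoc)
    show "ck_on k (\<lambda>x. (-1) * (inverse (f x) * (frechet_derivative f (at x) v * inverse (f x)))) U" for v
      by (intro ck_on_mult[OF assms(1)] ck_on_const Suc.IH ck_on_SucD[OF Suc.prems] ck_on_Suc_imp[OF Suc.prems])
  qed
qed

lemma ck_on_bounded_linear:
  assumes "open U" "bounded_linear f"
  shows "ck_on k f U"
proof (cases k)
  case (Suc m)
  have "(f has_derivative f) (at x)" for x
    by (rule bounded_linear_imp_has_derivative[OF assms(2)])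
  then show ?thesis unfolding Suc
    by (rule ck_on_SucI[OF assms(1)]) (simp_all add: ck_on_const)
qed (simp add: linear_continuous_on[OF assms(2)])

lemma smooth_map_on_differentiable:
  assumes "smooth_map_on f U" "x \<in> U"
  shows "(f has_derivative frechet_derivative f (at x)) (at x)"
proof -
  have "ck_on (Suc 0) f U" using assms by (simp only: smooth_map_on_def)
  then show ?thesis using assms by (auto simp: frechet_derivative_works)
qed

lemma smooth_map_on_bounded_linear:
  "open U \<Longrightarrow> bounded_linear f \<Longrightarrow> smooth_map_on f U"
  by (simp add: smooth_map_on_def ck_on_bounded_linear)

section \<open>Hyperbolic space in the paraboloid model\<close>

text \<open>This is \<open>r\<^sup>2\<close> for the vertical coordinate r of the upper
  half-space.\<close>

definition height :: "E3 \<Rightarrow> real" where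
  "height x = snd x - (cmod (fst x))\<^sup>2"

definition dheight :: "E3 \<Rightarrow> E3 \<Rightarrow> real" where
  "dheight x v = snd v - 2 * (fst x \<bullet> fst v)"

text \<open>The geodesics of the paraboloid model are the straight lines, so its Levi--Civita connection
  has the projectively flat form \<open>\<phi>(v) w + \<phi>(w) v\<close>; here \<open>\<phi> = - d height / (2 height)\<close>.\<close>

definition hyp_conn :: conn3 where
  "hyp_conn x v w = (- 1 / (2 * height x)) *\<^sub>R (dheight x v *\<^sub>R w + dheight x w *\<^sub>R v)"

lemma mem_paraboloid: "x \<in> paraboloid \<longleftrightarrow> height x > 0"
  by (cases x) (simp add: paraboloid_def height_def)

lemma hyp_metric_eq:
  "hyp_metric x v w = (dheight x v * dheight x w + 4 * height x * (fst v \<bullet> fst w)) / (4 * (height x)\<^sup>2)"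
  by (simp add: hyp_metric_def height_def dheight_def Let_def)

lemma open_paraboloid: "open paraboloid"
proof -
  have "paraboloid = {x. height x > 0}" by (auto simp: mem_paraboloid)
  moreover have "open {x :: E3. 0 < snd x - (cmod (fst x))\<^sup>2}"
    by (intro open_Collect_less continuous_intros)
  ultimately show ?thesis by (simp add: height_def)
qed

lemma connected_paraboloid: "connected paraboloid"
proof -
  have "paraboloid = (\<lambda>x. (fst x, snd x + (cmod (fst x))\<^sup>2)) ` (UNIV \<times> {0<..})"
  proof (intro equalityI subsetI)
    fix x :: E3 assume "x \<in> paraboloid"
    then show "x \<in> (\<lambda>x. (fst x, snd x + (cmod (fst x))\<^sup>2)) ` (UNIV \<times> {0<..})"
      by (intro image_eqI[of _ _ "(fst x, height x)"]) (auto simp: mem_paraboloid height_def)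
  qed (auto simp: paraboloid_def)
  moreover have "connected ((UNIV :: complex set) \<times> {0 :: real<..})"
    by (intro connected_Times) auto
  then have "connected ((\<lambda>x. (fst x, snd x + (cmod (fst x))\<^sup>2)) ` ((UNIV :: complex set) \<times> {0 :: real<..}))"
    by (rule connected_continuous_image[rotated]) (intro continuous_intros)
  ultimately show ?thesis by simp
qed

lemma paraboloid_nonempty: "paraboloid \<noteq> {}"
proof -
  have "(0, 1) \<in> paraboloid" by (simp add: paraboloid_def)
  then show ?thesis by blast
qed

lemma height_has_derivative: "(height has_derivative dheight x) (at x)"
proof -
  have "height = (\<lambda>x. snd x - fst x \<bullet> fst x)"
    by (simp add: fun_eq_iff height_def power2_norm_eq_inner)
  moreover have "((\<lambda>x. snd x - fst x \<bullet> fst x) has_derivative dheight x) (at x)"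
    by (auto intro!: derivative_eq_intros simp: dheight_def fun_eq_iff inner_commute)
  ultimately show ?thesis by simp
qed

lemma dheight_has_derivative: "((\<lambda>y. dheight y v) has_derivative (\<lambda>u. - 2 * (fst u \<bullet> fst v))) (at x)"
  unfolding dheight_def by (auto intro!: derivative_eq_intros)

lemma dheight_simps [simp]:
  "dheight x (v + w) = dheight x v + dheight x w"
  "dheight x (c *\<^sub>R v) = c * dheight x v"
  "dheight x 0 = 0"
  by (auto simp: dheight_def inner_add_right algebra_simps)

lemma bilinear_hyp_metric: "bilinear (hyp_metric x)"
  unfolding bilinear_def
  by (intro allI conjI linearI)
    (simp_all add: hyp_metric_eq inner_add_left inner_add_right add_divide_distrib algebra_simps)

lemma bilinear_hyp_conn: "bilinear (hyp_conn x)"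
  unfolding bilinear_def
  by (intro allI conjI linearI) (simp_all add: hyp_conn_def algebra_simps)

lemma hyp_metric_sym: "hyp_metric x v w = hyp_metric x w v"
  by (simp add: hyp_metric_eq inner_commute mult.commute)

lemma hyp_conn_sym: "hyp_conn x v w = hyp_conn x w v"
  by (simp add: hyp_conn_def add.commute)

lemma hyp_metric_pos:
  assumes "x \<in> paraboloid" "v \<noteq> 0"
  shows "hyp_metric x v v > 0"
proof -
  have h: "height x > 0" using assms by (simp add: mem_paraboloid)
  have "dheight x v * dheight x v + 4 * height x * (fst v \<bullet> fst v) > 0"
  proof (cases "fst v = 0")
    case True
    then have "snd v \<noteq> 0" using assms(2) by (simp add: prod_eq_iff)
    then show ?thesis using True by (auto simp: dheight_def zero_less_mult_iff)
  next
    case False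
    then have "4 * height x * (fst v \<bullet> fst v) > 0" using h by simp
    then show ?thesis using zero_le_square[of "dheight x v"] by linarith
  qed
  then show ?thesis using h by (simp add: hyp_metric_eq)
qed

text \<open>\<open>dheight\<close> is affine in the base point and is the derivative of
  \<open>height\<close>, so the quadratic function inherits smoothness from the affine one, one
  order higher.\<close>

lemma ck_on_height: "ck_on k height paraboloid"
  and ck_on_dheight: "ck_on k (\<lambda>x. dheight x v) paraboloid"
proof -
  note O = open_paraboloid
  have lin: "bounded_linear (\<lambda>x :: E3. - 2 * (fst x \<bullet> fst v))" for v
    unfolding linear_conv_bounded_linear[symmetric]
    by (intro linearI) (simp_all add: inner_add_left algebra_simps)
  have "ck_on k (\<lambda>x. snd v + - 2 * (fst x \<bullet> fst v)) paraboloid" for k v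
    by (intro ck_on_add O ck_on_const ck_on_bounded_linear lin)
  then show *: "ck_on k (\<lambda>x. dheight x v) paraboloid" for k v
    by (simp add: dheight_def)
  show "ck_on k height paraboloid"
  proof (rule ck_on_Suc_imp, rule ck_on_SucI[OF O])
    show "(height has_derivative dheight x) (at x)" for x by (rule height_has_derivative)
  qed (rule *)
qed

lemma ck_on_inverse_height: "ck_on k (\<lambda>x. inverse (height x)) paraboloid"
  by (intro ck_on_inverse open_paraboloid ck_on_height) (simp add: mem_paraboloid)

lemma metric_on_hyp_metric: "metric_on paraboloid hyp_metric"
proof -
  have "ck_on k (\<lambda>x. (dheight x v * dheight x w + (4 * (fst v \<bullet> fst w)) * height x) *
      ((1/4) * (inverse (height x) * inverse (height x)))) paraboloid" for k v w
    by (intro ck_on_mult ck_on_add ck_on_const ck_on_dheight ck_on_height ck_on_inverse_height open_paraboloid)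
  moreover have "(\<lambda>x. hyp_metric x v w) = (\<lambda>x. (dheight x v * dheight x w + (4 * (fst v \<bullet> fst w)) * height x) *
      ((1/4) * (inverse (height x) * inverse (height x))))" for v w
    by (simp add: hyp_metric_eq fun_eq_iff field_simps power2_eq_square)
  ultimately show ?thesis
    unfolding metric_on_def smooth_map_on_def
    by (simp only:) (use bilinear_hyp_metric hyp_metric_sym hyp_metric_pos in blast)
qed

lemma connection_on_hyp_conn: "connection_on paraboloid hyp_conn"
proof -
  have "ck_on k (\<lambda>x. ((-1/2) * inverse (height x)) *\<^sub>R (dheight x v *\<^sub>R w + dheight x w *\<^sub>R v)) paraboloid" for k v w
    by (intro ck_on_scaleR ck_on_mult ck_on_add ck_on_const ck_on_dheight ck_on_inverse_height open_paraboloid)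
  moreover have "(\<lambda>x. hyp_conn x v w) =
      (\<lambda>x. ((-1/2) * inverse (height x)) *\<^sub>R (dheight x v *\<^sub>R w + dheight x w *\<^sub>R v))" for v w
    by (rule ext) (simp add: hyp_conn_def inverse_eq_divide)
  ultimately show ?thesis
    unfolding connection_on_def smooth_map_on_def
    by (simp only:) (use bilinear_hyp_conn hyp_conn_sym in blast)
qed

section \<open>Metric compatibility, curvature and Levi--Civita property of the explicit
  connection\<close>

lemma hyp_metric_conn:
  "height x \<noteq> 0 \<Longrightarrow> hyp_metric x (hyp_conn x u v) w =
    - (dheight x u * hyp_metric x v w + dheight x v * hyp_metric x u w) / (2 * height x)"
  unfolding hyp_conn_def bilinear_lmul[OF bilinear_hyp_metric] bilinear_ladd[OF bilinear_hyp_metric]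
  by (simp add: field_simps)

text \<open>The derivative is written in the form that exhibits \<open>hyp_conn\<close> as a metric
  connection; after an index is lowered this is an identity in \<open>height\<close>,
  \<open>dheight\<close> and inner products.\<close>

lemma hyp_metric_has_derivative:
  assumes "x \<in> paraboloid"
  shows "((\<lambda>y. hyp_metric y v w) has_derivative
    (\<lambda>u. hyp_metric x (hyp_conn x u v) w + hyp_metric x v (hyp_conn x u w))) (at x)"
proof -
  have h: "height x \<noteq> 0" using assms by (simp add: mem_paraboloid)
  have "((\<lambda>y. (dheight y v * dheight y w + 4 * height y * (fst v \<bullet> fst w)) / (4 * (height y)\<^sup>2)) has_derivative
    (\<lambda>u. hyp_metric x (hyp_conn x u v) w + hyp_metric x v (hyp_conn x u w))) (at x)"
    by (rule derivative_eq_intros height_has_derivative dheight_has_derivative refl | simp add: h)+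
      (simp add: fun_eq_iff hyp_metric_sym[of x v] hyp_metric_conn[OF h],
       use h in \<open>simp add: hyp_metric_eq field_simps power2_eq_square inner_commute\<close>)
  then show ?thesis by (simp add: hyp_metric_eq)
qed

lemma hyp_conn_has_derivative:
  assumes "x \<in> paraboloid"
  shows "((\<lambda>y. hyp_conn y v w) has_derivative
    (\<lambda>u. (dheight x u / (2 * (height x)\<^sup>2)) *\<^sub>R (dheight x v *\<^sub>R w + dheight x w *\<^sub>R v)
       + (1 / height x) *\<^sub>R ((fst u \<bullet> fst v) *\<^sub>R w + (fst u \<bullet> fst w) *\<^sub>R v))) (at x)"
proof -
  have h: "height x \<noteq> 0" using assms by (simp add: mem_paraboloid)
  show ?thesis unfolding hyp_conn_def
    by (rule derivative_eq_intros height_has_derivative dheight_has_derivative refl | simp add: h)+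
      (use h in \<open>simp add: fun_eq_iff prod_eq_iff complex_eq_iff field_simps power2_eq_square\<close>)
qed

lemma dheight_hyp_conn: "dheight x (hyp_conn x v w) = - (dheight x v * dheight x w) / height x"
  unfolding hyp_conn_def dheight_simps by (simp add: field_simps)

lemma hyp_conn_hyp_conn:
  "hyp_conn x u (hyp_conn x v w) =
    (- 1 / (2 * height x)) *\<^sub>R (dheight x u *\<^sub>R hyp_conn x v w
      + (- (dheight x v * dheight x w) / height x) *\<^sub>R u)"
  by (subst hyp_conn_def) (simp only: dheight_hyp_conn)

text \<open>This is the curvature tensor of constant sectional curvature -1.\<close>

lemma curvature_hyp_conn:
  assumes "x \<in> paraboloid"
  shows "curvature hyp_conn x e v w = hyp_metric x e w *\<^sub>R v - hyp_metric x v w *\<^sub>R e"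
proof -
  have h: "height x \<noteq> 0" using assms by (simp add: mem_paraboloid)
  show ?thesis
    unfolding curvature_def frechet_derivative_eq[OF hyp_conn_has_derivative[OF assms]] hyp_conn_hyp_conn
    using h
    by (simp add: hyp_conn_def hyp_metric_eq prod_eq_iff complex_eq_iff inner_commute field_simps power2_eq_square)
qed

text \<open>In the trace over \<open>e\<close> the first curvature term counts once and the second
  three times, once per dimension: 1 - 3 = -2.\<close>

lemma ricci_hyp_conn:
  assumes "x \<in> paraboloid"
  shows "ricci hyp_conn x v w = - 2 * hyp_metric x v w"
proof -
  have lin: "linear (\<lambda>v. hyp_metric x v w)" using bilinear_hyp_metric unfolding bilinear_def by blast
  have "ricci hyp_conn x v w = (\<Sum>e\<in>Basis. (v \<bullet> e) * hyp_metric x e w) - (\<Sum>e\<in>(Basis :: E3 set). hyp_metric x v w)"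
    by (simp add: ricci_def curvature_hyp_conn[OF assms] inner_diff_left sum_subtractf mult.commute)
  also have "(\<Sum>e\<in>Basis. (v \<bullet> e) * hyp_metric x e w) = hyp_metric x (\<Sum>e\<in>Basis. (v \<bullet> e) *\<^sub>R e) w"
    by (simp add: linear_sum[OF lin] linear_cmul[OF lin])
  also have "(\<Sum>e\<in>Basis. (v \<bullet> e) *\<^sub>R e) = v" by (rule euclidean_representation)
  finally show ?thesis by simp
qed

lemma cov_metric_hyp:
  "x \<in> paraboloid \<Longrightarrow> cov_metric hyp_metric hyp_conn x u v w = 0"
  by (simp add: cov_metric_def frechet_derivative_eq[OF hyp_metric_has_derivative])

lemma einstein_weyl_hyp: "einstein_weyl paraboloid hyp_metric hyp_conn"
proof -
  have "\<exists>\<omega>. \<forall>x\<in>paraboloid. \<forall>u v w. cov_metric hyp_metric hyp_conn x u v w = \<omega> x u * hyp_metric x v w"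
    by (rule exI[of _ "\<lambda>_ _. 0"]) (simp add: cov_metric_hyp)
  \<comment> \<open>\<open>einstein_weyl\<close> symmetrises the Ricci form without a factor 1/2,
    which doubles -2.\<close>
  moreover have "\<exists>\<Lambda>. \<forall>x\<in>paraboloid. \<forall>v w. ricci hyp_conn x v w + ricci hyp_conn x w v = \<Lambda> x * hyp_metric x v w"
    by (rule exI[of _ "\<lambda>_. - 4"]) (simp add: ricci_hyp_conn hyp_metric_sym)
  ultimately show ?thesis
    unfolding einstein_weyl_def using metric_on_hyp_metric connection_on_hyp_conn by blast
qed

text \<open>Alternating the two transpositions runs through all six orders of the arguments and
  returns with three sign changes. This is the algebra behind the uniqueness of the Levi--Civita
  connection.\<close>

lemma sym_skew_zero:
  fixes T :: "'a \<Rightarrow> 'a \<Rightarrow> 'a \<Rightarrow> real"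
  assumes "\<And>u v w. T u v w = T v u w" "\<And>u v w. T u v w = - T u w v"
  shows "T u v w = 0"
proof -
  have "T u v w = - T u w v" by (rule assms(2))
  also have "\<dots> = - T w u v" using assms(1)[of u w v] by simp
  also have "\<dots> = T w v u" using assms(2)[of w u v] by simp
  also have "\<dots> = T v w u" by (rule assms(1))
  also have "\<dots> = - T v u w" by (rule assms(2))
  also have "\<dots> = - T u v w" using assms(1)[of u v w] by simp
  finally show ?thesis by simp
qed

lemma levi_civita_hyp_metric:
  assumes "x \<in> paraboloid"
  shows "levi_civita hyp_metric x = hyp_conn x"
proof -
  note D = frechet_derivative_eq[OF hyp_metric_has_derivative[OF assms]]
  have "G u v = hyp_conn x u v" if G: "\<And>u v. G u v = G v u"
    "\<And>u v w. hyp_metric x (hyp_conn x u v) w + hyp_metric x v (hyp_conn x u w)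
      = hyp_metric x (G u v) w + hyp_metric x v (G u w)" for G u v
  proof -
    \<comment> \<open>The difference of two torsion-free metric connections with its index lowered:
      symmetric in the first two arguments by torsion-freeness, skew in the last two by
      compatibility.\<close>
    define T where "T u v w = hyp_metric x (G u v - hyp_conn x u v) w" for u v w
    have d: "hyp_metric x (a - b) c = hyp_metric x a c - hyp_metric x b c" for a b c
      by (rule bilinear_lsub[OF bilinear_hyp_metric])
    have "T u v w = T v u w" for u v w unfolding T_def by (simp add: G(1)[of u v] hyp_conn_sym[of x u v])
    moreover have "T u v w = - T u w v" for u v w
      using G(2)[of u v w] unfolding T_def d by (simp add: hyp_metric_sym[of x v])
    ultimately have "T u v w = 0" for w by (rule sym_skew_zero)
    then have "hyp_metric x (G u v - hyp_conn x u v) (G u v - hyp_conn x u v) = 0" by (simp add: T_def)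
    then show ?thesis using hyp_metric_pos[OF assms] by (metis eq_iff_diff_eq_0 less_irrefl)
  qed
  then have "G = hyp_conn x" if "\<forall>u v. G u v = G v u"
    "\<forall>u v w. hyp_metric x (hyp_conn x u v) w + hyp_metric x v (hyp_conn x u w)
      = hyp_metric x (G u v) w + hyp_metric x v (G u w)" for G
    using that by (intro ext) blast
  then show ?thesis unfolding levi_civita_def D
    by (intro the_equality conjI allI bilinear_hyp_conn hyp_conn_sym refl) blast
qed

section \<open>Uniqueness of the Einstein--Weyl structure\<close>

text \<open>A complex vector v + i w is null iff v and w are orthogonal of equal length, so the null
  cone determines orthogonality. The ratio of the two squared lengths then agrees on any two vectors
  that are not orthogonal, and is therefore constant.\<close>

lemma same_null_cone_proportional:
  fixes g g' :: "'a::real_vector \<Rightarrow> 'a \<Rightarrow> real"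
  assumes g: "bilinear g" "\<And>v w. g v w = g w v" "\<And>v. v \<noteq> 0 \<Longrightarrow> g v v > 0"
    and g': "bilinear g'" "\<And>v w. g' v w = g' w v" "\<And>v. v \<noteq> 0 \<Longrightarrow> g' v v > 0"
    and null: "\<And>v w. g v v = g w w \<and> g v w = 0 \<longleftrightarrow> g' v v = g' w w \<and> g' v w = 0"
  shows "\<exists>c>0. \<forall>v w. g' v w = c * g v w"
proof (cases "\<exists>e :: 'a. e \<noteq> 0")
  case True
  then obtain e :: 'a where e: "e \<noteq> 0" by blast
  have orth: "g' v w = 0" if "g v w = 0" for v w
  proof (cases "v = 0 \<or> w = 0")
    case True
    then show ?thesis using bilinear_lzero[OF g'(1)] bilinear_rzero[OF g'(1)] by auto
  next
    case False
    \<comment> \<open>Rescaling w to the length of v turns an orthogonal pair into a null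
      one.\<close>
    define s where "s = sqrt (g v v / g w w)"
    have s: "s > 0" "s * s * g w w = g v v"
      using g(3)[of v] g(3)[of w] False by (auto simp: s_def less_imp_le)
    have "g v v = g (s *\<^sub>R w) (s *\<^sub>R w) \<and> g v (s *\<^sub>R w) = 0"
      using that s by (simp add: bilinear_lmul[OF g(1)] bilinear_rmul[OF g(1)] mult.assoc)
    then have "g' v (s *\<^sub>R w) = 0" using null by blast
    then show ?thesis using s by (simp add: bilinear_rmul[OF g'(1)])
  qed
  define r where "r v = g' v v / g v v" for v
  have r: "g' v w = r v * g v w" if "v \<noteq> 0" for v w
  proof -
    have "g v (w - (g v w / g v v) *\<^sub>R v) = 0"
      using g(3)[OF that] by (simp add: bilinear_rsub[OF g(1)] bilinear_rmul[OF g(1)])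
    from orth[OF this] show ?thesis
      using g(3)[OF that] by (simp add: bilinear_rsub[OF g'(1)] bilinear_rmul[OF g'(1)] r_def)
  qed
  have r_eq: "r v = r w" if "v \<noteq> 0" "w \<noteq> 0" "g v w \<noteq> 0" for v w
    using r[OF that(1), of w] r[OF that(2), of v] g(2)[of v w] g'(2)[of v w] that(3) by simp
  have const: "r v = r e" if "v \<noteq> 0" for v
  proof (cases "g v e = 0")
    case True
    \<comment> \<open>If v and e are orthogonal, v + e is orthogonal to neither and links their
      ratios.\<close>
    then have "g v (v + e) \<noteq> 0" "g (v + e) e \<noteq> 0"
      using g(3)[OF that] g(3)[OF e] by (auto simp: bilinear_radd[OF g(1)] bilinear_ladd[OF g(1)])
    moreover from this have "v + e \<noteq> 0" using bilinear_rzero[OF g(1)] by metis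
    ultimately show ?thesis using r_eq that e by metis
  qed (use r_eq that e in blast)
  have "g' v w = r e * g v w" for v w
  proof (cases "v = 0")
    case True
    then show ?thesis by (simp add: bilinear_lzero[OF g(1)] bilinear_lzero[OF g'(1)])
  qed (simp add: r const)
  moreover have "r e > 0" using g(3)[OF e] g'(3)[OF e] by (simp add: r_def)
  ultimately show ?thesis by blast
next
  case False
  then have "v = 0" for v :: 'a by blast
  then have "g' v w = 1 * g v w" for v w
    by (metis bilinear_lzero[OF g(1)] bilinear_lzero[OF g'(1)] mult_zero_right)
  then show ?thesis by (metis zero_less_one)
qed

text \<open>\<open>D\<close> is the difference of two Weyl connections with the same unparametrised geodesics. It has the
  form \<open>\<psi>(u) v + \<psi>(v) u\<close>, and testing \<open>compat\<close> on \<open>v = w = u\<close> and on \<open>v = w\<close> orthogonal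
  to \<open>u\<close> gives \<open>4 \<psi> = \<theta>\<close> and \<open>2 \<psi> = \<theta>\<close>.\<close>

lemma weyl_projective_zero:
  fixes g :: "E3 \<Rightarrow> E3 \<Rightarrow> real" and D :: "E3 \<Rightarrow> E3 \<Rightarrow> E3"
  assumes g: "bilinear g" "\<And>v w. g v w = g w v" "\<And>v. v \<noteq> 0 \<Longrightarrow> g v v > 0"
    and D: "bilinear D" "\<And>v w. D v w = D w v" "\<And>v. \<exists>k. D v v = k *\<^sub>R v"
    and compat: "\<And>u v w. g (D u v) w + g v (D u w) = \<theta> u * g v w"
  shows "D u v = 0"
proof -
  have diag: "D v v = (\<theta> v / 2) *\<^sub>R v" for v
  proof (cases "v = 0")
    case False
    obtain k where k: "D v v = k *\<^sub>R v" using D(3) by blast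
    have "2 * k * g v v = \<theta> v * g v v"
      using compat[of v v v] k by (simp add: bilinear_lmul[OF g(1)] bilinear_rmul[OF g(1)])
    then have "2 * k = \<theta> v" using g(3)[OF False] by simp
    then show ?thesis using k by simp
  qed (simp add: bilinear_lzero[OF D(1)])
  \<comment> \<open>Additivity of \<theta> has to be extracted from \<open>compat\<close>: evaluated
    on one fixed vector, it expresses \<theta> through the bilinear \<open>D\<close>.\<close>
  have \<theta>_eq: "\<theta> u = 2 * g (D u (1, 0)) (1, 0) / g (1, 0) (1, 0)" for u
  proof -
    have "g (1, 0) (1, 0) > 0" by (rule g(3)) (simp add: prod_eq_iff)
    then show ?thesis using compat[of u "(1, 0)" "(1, 0)"] g(2)[of "(1,0)" "D u (1, 0)"] by (simp add: field_simps)
  qed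
  have \<theta>_add: "\<theta> (u + v) = \<theta> u + \<theta> v" for u v
    unfolding \<theta>_eq bilinear_ladd[OF D(1)] bilinear_ladd[OF g(1)]
    by (simp add: add_divide_distrib distrib_left)
  have D_eq: "D u v = (\<theta> u / 4) *\<^sub>R v + (\<theta> v / 4) *\<^sub>R u" for u v
  proof -
    have "D u u + D v v + 2 *\<^sub>R D u v = D (u + v) (u + v)"
      using D(2)[of u v] by (simp add: bilinear_ladd[OF D(1)] bilinear_radd[OF D(1)] scaleR_2)
    then have "2 *\<^sub>R D u v = (\<theta> u / 2) *\<^sub>R v + (\<theta> v / 2) *\<^sub>R u"
      unfolding diag \<theta>_add by (simp add: algebra_simps add_divide_distrib)
    then have "(1/2) *\<^sub>R (2 *\<^sub>R D u v) = (1/2) *\<^sub>R ((\<theta> u / 2) *\<^sub>R v + (\<theta> v / 2) *\<^sub>R u)" by simp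
    then show ?thesis by (simp add: scaleR_add_right)
  qed
  have "\<theta> u = 0" for u
  proof -
    \<comment> \<open>A nonzero vector orthogonal to u, found in the plane spanned by (1, 0) and (0,
      1).\<close>
    define v :: E3 where "v = (if g u (1, 0) = 0 then (1, 0) else g u (0, 1) *\<^sub>R (1, 0) - g u (1, 0) *\<^sub>R (0, 1))"
    have v: "v \<noteq> 0" by (auto simp: v_def prod_eq_iff)
    have "g u v = 0"
      by (simp add: v_def bilinear_rsub[OF g(1)] bilinear_rmul[OF g(1)] del: scaleR_Pair)
    then have "\<theta> u * g v v / 2 = \<theta> u * g v v"
      using compat[of u v v] g(2)[of u v]
      by (simp add: D_eq bilinear_lmul[OF g(1)] bilinear_rmul[OF g(1)] bilinear_ladd[OF g(1)] bilinear_radd[OF g(1)])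
    then show ?thesis using g(3)[OF v] by simp
  qed
  then show ?thesis by (simp add: D_eq)
qed

lemma same_EW_unique:
  assumes U: "open U"
    and EW: "einstein_weyl U g \<Gamma>" "einstein_weyl U g' \<Gamma>'"
    and null: "hitchin_null U f g" "hitchin_null U f g'"
    and proj: "\<And>x v. x \<in> U \<Longrightarrow> \<exists>k. \<Gamma>' x v v - \<Gamma> x v v = k *\<^sub>R v"
  shows "same_EW U g \<Gamma> g' \<Gamma>'"
proof -
  have met: "metric_on U g" "metric_on U g'" and con: "connection_on U \<Gamma>" "connection_on U \<Gamma>'"
    using EW by (auto simp: einstein_weyl_def)
  have g: "bilinear (g x)" "g x v w = g x w v" "v \<noteq> 0 \<Longrightarrow> g x v v > 0"
    and g': "bilinear (g' x)" "g' x v w = g' x w v" "v \<noteq> 0 \<Longrightarrow> g' x v v > 0" if "x \<in> U" for x v w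
    using met that unfolding metric_on_def by blast+
  have \<Gamma>: "bilinear (\<Gamma> x)" "\<Gamma> x v w = \<Gamma> x w v"
    and \<Gamma>': "bilinear (\<Gamma>' x)" "\<Gamma>' x v w = \<Gamma>' x w v" if "x \<in> U" for x v w
    using con that unfolding connection_on_def by blast+
  have conf: "\<exists>c>0. \<forall>v w. g' x v w = c * g x v w" if x: "x \<in> U" for x
  proof (rule same_null_cone_proportional[OF g(1)[OF x] g(2)[OF x] g(3)[OF x] g'(1)[OF x] g'(2)[OF x] g'(3)[OF x]])
    show "g x v v = g x w w \<and> g x v w = 0 \<longleftrightarrow> g' x v v = g' x w w \<and> g' x v w = 0" for v w
      using null x unfolding hitchin_null_def by blast
  qed
  define e :: E3 where "e = (1, 0)"
  have e: "e \<noteq> 0" by (simp add: e_def prod_eq_iff)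
  \<comment> \<open>The conformal factor is given pointwise by an existential. As a quotient of
    values on one fixed vector it becomes differentiable.\<close>
  define c where "c x = g' x e e / g x e e" for x
  have c: "c x > 0" "g' x v w = c x * g x v w" if x: "x \<in> U" for x v w
  proof -
    obtain k where k: "k > 0" "\<And>v w. g' x v w = k * g x v w" using conf[OF x] by blast
    then have "c x = k" using g(3)[OF x e] by (simp add: c_def)
    then show "c x > 0" "g' x v w = c x * g x v w" using k by auto
  qed
  obtain \<omega> where \<omega>: "\<And>x u v w. x \<in> U \<Longrightarrow> cov_metric g \<Gamma> x u v w = \<omega> x u * g x v w"
    using EW(1) unfolding einstein_weyl_def by metis
  obtain \<omega>' where \<omega>': "\<And>x u v w. x \<in> U \<Longrightarrow> cov_metric g' \<Gamma>' x u v w = \<omega>' x u * g' x v w"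
    using EW(2) unfolding einstein_weyl_def by metis
  have "\<Gamma>' x v w = \<Gamma> x v w" if x: "x \<in> U" for x v w
  proof -
    note gb = bilinear_lsub[OF g(1)[OF x]] bilinear_rsub[OF g(1)[OF x]]
    have dg: "((\<lambda>y. g y v w) has_derivative frechet_derivative (\<lambda>y. g y v w) (at x)) (at x)"
      and dg': "((\<lambda>y. g' y v w) has_derivative frechet_derivative (\<lambda>y. g' y v w) (at x)) (at x)" for v w
    proof -
      have sm: "smooth_map_on (\<lambda>y. g y v w) U" "smooth_map_on (\<lambda>y. g' y v w) U"
        using met unfolding metric_on_def by blast+
      show "((\<lambda>y. g y v w) has_derivative frechet_derivative (\<lambda>y. g y v w) (at x)) (at x)"
        "((\<lambda>y. g' y v w) has_derivative frechet_derivative (\<lambda>y. g' y v w) (at x)) (at x)"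
        by (rule smooth_map_on_differentiable[OF sm(1) x], rule smooth_map_on_differentiable[OF sm(2) x])
    qed
    obtain c' where c': "(c has_derivative c') (at x)"
    proof -
      have "g x e e \<noteq> 0" using g(3)[OF x e] by simp
      from that[unfolded c_def, OF has_derivative_divide[OF dg' dg this]] show thesis .
    qed
    have dg'_eq: "frechet_derivative (\<lambda>y. g' y v w) (at x) u
        = c x * frechet_derivative (\<lambda>y. g y v w) (at x) u + c' u * g x v w" for u v w
    proof -
      have "((\<lambda>y. g' y v w) has_derivative
          (\<lambda>u. c x * frechet_derivative (\<lambda>y. g y v w) (at x) u + c' u * g x v w)) (at x)"
        by (rule has_derivative_transform_within_open[OF has_derivative_mult[OF c' dg] U x]) (simp add: c)
      then show ?thesis by (simp add: frechet_derivative_eq)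
    qed
    define D where "D v w = \<Gamma>' x v w - \<Gamma> x v w" for v w
    have "D v w = 0"
    proof (rule weyl_projective_zero[where D = D, OF g(1)[OF x] g(2)[OF x] g(3)[OF x]])
      show "bilinear D"
        using \<Gamma>(1)[OF x] \<Gamma>'(1)[OF x] unfolding D_def bilinear_def by (auto intro: linear_compose_sub)
      show "D v w = D w v" for v w
        unfolding D_def using \<Gamma>(2)[OF x] \<Gamma>'(2)[OF x] by metis
      show "\<exists>k. D v v = k *\<^sub>R v" for v unfolding D_def using proj[OF x] .
      \<comment> \<open>Passing from g to c g shifts the Weyl one-form by the logarithmic derivative
        of c.\<close>
      show "g x (D u v) w + g x v (D u w) = (\<omega> x u + c' u / c x - \<omega>' x u) * g x v w" for u v w
        using \<omega>[OF x, of u v w] \<omega>'[OF x, of u v w] c(1)[OF x]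
        unfolding cov_metric_def dg'_eq c(2)[OF x] D_def gb by (simp add: field_simps)
    qed
    then show ?thesis by (simp add: D_def)
  qed
  then show ?thesis using conf by (simp add: same_EW_def)
qed

section \<open>Lines of the family\<close>

lemma vec2_eq_iff: "z = w \<longleftrightarrow> z $ 1 = w $ 1 \<and> z $ 2 = w $ 2" for z w :: "'a^2"
  by (simp add: vec_eq_iff forall_2)

lemma ev_eq: "ev F z w = F $ 1 $ 1 * z $ 1 * w $ 1 + F $ 1 $ 2 * z $ 1 * w $ 2
    + F $ 2 $ 1 * z $ 2 * w $ 1 + F $ 2 $ 2 * z $ 2 * w $ 2"
  by (simp add: ev_def sum_2)

lemma hpt_scale:
  assumes "c \<noteq> 0"
  shows "hpt (c *s z) = hpt z"
proof -
  have "d *s z = (d / c) *s (c *s z)" "d *s (c *s z) = (d * c) *s z" for d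
    using assms by (simp_all add: vec2_eq_iff)
  then have "\<exists>d'. d *s z = d' *s (c *s z) \<and> d' \<noteq> 0" "\<exists>d'. d *s (c *s z) = d' *s z \<and> d' \<noteq> 0" if "d \<noteq> 0" for d
    using assms that by (metis divide_eq_0_iff, metis mult_eq_0_iff)
  then show ?thesis unfolding hpt_def by blast
qed

lemma hpt_eqD: "hpt z = hpt w \<Longrightarrow> \<exists>c. c \<noteq> 0 \<and> w = c *s z"
proof -
  assume eq: "hpt z = hpt w"
  have "w \<in> hpt w" by (auto simp: hpt_def intro!: exI[of _ 1])
  then show ?thesis using eq by (auto simp: hpt_def)
qed

lemma hpt_eq_iff:
  assumes "z \<noteq> 0" "w \<noteq> 0"
  shows "hpt z = hpt w \<longleftrightarrow> wedge z w = 0"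
proof
  assume "hpt z = hpt w"
  then show "wedge z w = 0" using hpt_eqD[of z w] by (auto simp: wedge_def)
next
  assume *: "wedge z w = 0"
  define i :: 2 where "i = (if z $ 1 \<noteq> 0 then 1 else 2)"
  define c where "c = w $ i / z $ i"
  have "z $ i \<noteq> 0" using assms by (auto simp: vec2_eq_iff i_def)
  then have w: "w = c *s z" using * by (auto simp: vec2_eq_iff wedge_def i_def c_def field_simps split: if_splits)
  then have "c \<noteq> 0" using assms by auto
  then show "hpt z = hpt w" using w hpt_scale by metis
qed

text \<open>\<open>ev\<close> is bihomogeneous, so incidence does not depend on the chosen
  representatives.\<close>

lemma mem_curve:
  assumes "z \<noteq> 0" "w \<noteq> 0"
  shows "(hpt z, hpt w) \<in> curve F \<longleftrightarrow> ev F z w = 0"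
proof
  assume "(hpt z, hpt w) \<in> curve F"
  then obtain z' w' where *: "hpt z = hpt z'" "hpt w = hpt w'" "ev F z' w' = 0"
    by (auto simp: curve_def)
  obtain c d where cd: "c \<noteq> 0" "z' = c *s z" "d \<noteq> 0" "w' = d *s w"
    using hpt_eqD[OF *(1)] hpt_eqD[OF *(2)] by blast
  have "ev F z' w' = c * d * ev F z w" by (simp add: cd ev_eq algebra_simps)
  then show "ev F z w = 0" using * cd by simp
qed (use assms in \<open>auto simp: curve_def\<close>)

text \<open>Substituting \<open>\<eta> \<mapsto> - \<eta>\<close> turns the curves of the proposition into the standard minitwistor
  lines; the sign changes make \<open>(a, b)\<close> range over \<open>paraboloid\<close>.\<close>

definition line_form :: "E3 \<Rightarrow> complex^2^2" where
  "line_form x = form11 (- fst x) (cnj (fst x)) (- complex_of_real (snd x))"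

definition dline_form :: "E3 \<Rightarrow> complex^2^2" where
  "dline_form v = vector [vector [0, - fst v], vector [cnj (fst v), - complex_of_real (snd v)]]"

lemma ev_line_form: "ev (line_form x) z w = z $ 1 * w $ 1 - fst x * z $ 1 * w $ 2 + cnj (fst x) * z $ 2 * w $ 1
    - complex_of_real (snd x) * z $ 2 * w $ 2"
  by (simp add: ev_eq line_form_def form11_def)

lemma linear_dline_form: "linear dline_form"
  by (rule linearI)
    (simp_all add: dline_form_def vec2_eq_iff scaleR_conv_of_real[where 'a=complex] algebra_simps)

lemma line_form_has_derivative: "(line_form has_derivative dline_form) (at x)"
proof -
  have "(dline_form has_derivative dline_form) (at x)"
    by (rule bounded_linear_imp_has_derivative) (use linear_dline_form in \<open>simp add: linear_conv_bounded_linear\<close>)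
  then have "((\<lambda>x. line_form 0 + dline_form x) has_derivative dline_form) (at x)"
    using has_derivative_add[OF has_derivative_const] by fastforce
  moreover have "line_form = (\<lambda>x. line_form 0 + dline_form x)"
    by (simp add: fun_eq_iff line_form_def dline_form_def form11_def vec2_eq_iff)
  ultimately show ?thesis by simp
qed

lemma smooth_line_form: "smooth_map_on line_form paraboloid"
proof -
  have "ck_on (Suc k) line_form paraboloid" for k
    by (rule ck_on_SucI[OF open_paraboloid line_form_has_derivative]) (rule ck_on_const)
  then show ?thesis unfolding smooth_map_on_def using ck_on_Suc_imp by blast
qed

lemma ev_line_form_add_scaleR: "ev (line_form (x + s *\<^sub>R v)) z w = ev (line_form x) z w + complex_of_real s * ev (dline_form v) z w"
  by (simp add: ev_eq line_form_def dline_form_def form11_def scaleR_conv_of_real algebra_simps)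

lemma normal_section_line_form:
  "normal_section line_form x v w = vector [vector [0, - (fst v + \<i> * fst w)],
     vector [cnj (fst v) + \<i> * cnj (fst w), - (complex_of_real (snd v) + \<i> * complex_of_real (snd w))]]"
  by (simp add: normal_section_def frechet_derivative_eq[OF line_form_has_derivative] dline_form_def vec2_eq_iff algebra_simps)

section \<open>The lines as graphs of Moebius maps\<close>

lemma of_real_height: "complex_of_real (height x) = complex_of_real (snd x) - fst x * cnj (fst x)"
  unfolding height_def of_real_diff complex_norm_square ..

text \<open>Solving the equation of the line for \<eta> gives \<eta> = (a \<zeta> + b) / (\<zeta> +
  cnj a). The determinant of this Moebius map is \<open>- height x\<close>, so it is invertible on
  the paraboloid.\<close>

definition line_map :: "E3 \<Rightarrow> complex^2 \<Rightarrow> complex^2" where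
  "line_map x z = vector [fst x * z $ 1 + complex_of_real (snd x) * z $ 2, z $ 1 + cnj (fst x) * z $ 2]"

lemma ev_line_form_wedge: "ev (line_form x) z w = - wedge (line_map x z) w"
  by (simp add: ev_line_form line_map_def wedge_def algebra_simps)

lemma line_map_wedge: "wedge (line_map x z) (line_map x w) = - complex_of_real (height x) * wedge z w"
  by (simp add: line_map_def wedge_def of_real_height algebra_simps)

lemma line_map_nonzero:
  assumes "x \<in> paraboloid" "z \<noteq> 0"
  shows "line_map x z \<noteq> 0"
proof
  assume "line_map x z = 0"
  then have "wedge z w = 0" for w
    using line_map_wedge[of x z w] assms(1) by (simp add: wedge_def mem_paraboloid)
  from this[of "vector [1, 0]"] this[of "vector [0, 1]"] show False
    using assms(2) by (simp add: wedge_def vec2_eq_iff)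
qed

lemma curve_line_form:
  assumes "x \<in> paraboloid"
  shows "curve (line_form x) = {(hpt z, hpt (line_map x z)) | z. z \<noteq> 0}"
proof (intro equalityI subsetI)
  fix p assume "p \<in> curve (line_form x)"
  then obtain z w where p: "p = (hpt z, hpt w)" "z \<noteq> 0" "w \<noteq> 0" "ev (line_form x) z w = 0"
    by (auto simp: curve_def)
  then have "hpt (line_map x z) = hpt w"
    using hpt_eq_iff[OF line_map_nonzero[OF assms p(2)] p(3)] by (simp add: ev_line_form_wedge)
  then show "p \<in> {(hpt z, hpt (line_map x z)) | z. z \<noteq> 0}" using p by auto
next
  fix p assume "p \<in> {(hpt z, hpt (line_map x z)) | z. z \<noteq> 0}"
  then obtain z where p: "p = (hpt z, hpt (line_map x z))" "z \<noteq> 0" by blast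
  show "p \<in> curve (line_form x)"
    unfolding p(1) mem_curve[OF p(2) line_map_nonzero[OF assms p(2)]] by (simp add: ev_line_form_wedge wedge_def)
qed

lemma hom_map_1I:
  assumes "\<And>z. A z = vector [a * z $ 1 + b * z $ 2, c * z $ 1 + d * z $ 2]" "\<And>z. z \<noteq> 0 \<Longrightarrow> A z \<noteq> 0"
  shows "hom_map 1 A"
proof -
  have "A z = (\<Sum>i\<le>1. (z $ 1 ^ i * z $ 2 ^ (1 - i)) *s (if i = 0 then vector [b, d] else vector [a, c]))" for z
    by (simp add: assms(1) vec2_eq_iff mult.commute)
  then show ?thesis unfolding hom_map_def
    using assms(2) by (intro conjI exI[of _ "\<lambda>i. if i = 0 then vector [b, d] else vector [a, c]"]) simp_all
qed

text \<open>The parametrisation of the graph has the identity as first component, which makes it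
  injective and immersive. Its bidegree (1, 1) gives self-intersection 1 + 1.\<close>

lemma minitwistor_line_line_form:
  assumes x: "x \<in> paraboloid"
  shows "minitwistor_line (curve (line_form x))"
proof -
  have "hom_map 1 (\<lambda>z. z)"
    by (rule hom_map_1I[of _ 1 0 0 1]) (auto simp: vec2_eq_iff)
  moreover have "hom_map 1 (line_map x)"
    by (rule hom_map_1I[of _ "fst x" "complex_of_real (snd x)" 1 "cnj (fst x)"])
      (auto simp: line_map_nonzero[OF x], simp add: line_map_def)
  ultimately have "smooth_rational_curve 1 1 (curve (line_form x))"
    unfolding smooth_rational_curve_def curve_line_form[OF x]
    by (intro exI[of _ "\<lambda>z. z"] exI[of _ "line_map x"]) (auto simp: frechet_derivative_eq[OF has_derivative_ident])
  then show ?thesis unfolding minitwistor_line_def by (intro exI[of _ 1]) simp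
qed

text \<open>On the graph a normal section becomes a binary quadratic form. Its vanishing at [1:0],
  [0:1] and [1:1] gives linear equations for p, q, r that are nonsingular because
  \<open>height x\<close> is nonzero.\<close>

lemma complete_family_line_form: "complete_family paraboloid line_form"
proof -
  have "v = 0 \<and> w = 0" if x: "x \<in> paraboloid" and sub: "curve (line_form x) \<subseteq> curve (normal_section line_form x v w)" for x v w
  proof -
    have h: "complex_of_real (height x) \<noteq> 0" using x by (simp add: mem_paraboloid)
    define p where "p = fst v + \<i> * fst w"
    define q where "q = cnj (fst v) + \<i> * cnj (fst w)"
    define r where "r = complex_of_real (snd v) + \<i> * complex_of_real (snd w)"
    have "ev (normal_section line_form x v w) z (line_map x z) = 0" if "z \<noteq> 0" for z
      using sub that line_map_nonzero[OF x that] by (auto simp: curve_line_form[OF x] mem_curve dest!: subsetD)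
    then have *: "- p * z1 * (z1 + cnj (fst x) * z2) + q * z2 * (fst x * z1 + snd x * z2)
        - r * z2 * (z1 + cnj (fst x) * z2) = 0" if "z1 \<noteq> 0 \<or> z2 \<noteq> 0" for z1 z2
      using that by (force simp: ev_eq normal_section_line_form line_map_def vec2_eq_iff p_def q_def r_def algebra_simps
          dest: spec[of _ "vector [z1, z2]"])
    have p: "p = 0" using *[of 1 0] by simp
    have 1: "q * snd x - r * cnj (fst x) = 0" using *[of 0 1] by simp
    have 2: "q * fst x - r = 0" using *[of 1 1] p 1 by (simp add: algebra_simps)
    have "q * complex_of_real (height x) = 0" using 1 2 by (simp add: of_real_height algebra_simps)
    then have q: "q = 0" using h by simp
    then have r: "r = 0" using 2 by simp
    \<comment> \<open>p and \<open>cnj q\<close> are \<open>fst v\<close> plus and minus i times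
      \<open>fst w\<close>.\<close>
    from p q have "fst v = 0 \<and> fst w = 0" by (simp add: p_def q_def complex_eq_iff)
    moreover from r have "snd v = 0 \<and> snd w = 0" by (simp add: r_def complex_eq_iff)
    ultimately show ?thesis by (simp add: prod_eq_iff)
  qed
  then show ?thesis
    unfolding complete_family_def using smooth_line_form minitwistor_line_line_form by blast
qed

section \<open>The Hitchin correspondence for the family\<close>

definition det2 :: "complex^2^2 \<Rightarrow> complex" where
  "det2 F = F $ 1 $ 1 * F $ 2 $ 2 - F $ 1 $ 2 * F $ 2 $ 1"

text \<open>The polarisation of \<open>det2\<close>: the coefficient of t in the determinant of F +
  t S.\<close>

definition mixed_det2 :: "complex^2^2 \<Rightarrow> complex^2^2 \<Rightarrow> complex" where
  "mixed_det2 F S = F $ 1 $ 1 * S $ 2 $ 2 + S $ 1 $ 1 * F $ 2 $ 2 - F $ 1 $ 2 * S $ 2 $ 1 - S $ 1 $ 2 * F $ 2 $ 1"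

text \<open>The mixed determinant is the trace of F times the adjugate of the singular matrix with
  rows (A, B) and (C, D). That adjugate is a multiple of the right kernel vector w times the
  transpose of the left kernel vector z, so the trace is a multiple of F(z, w) = 0.\<close>

lemma mixed_det_kernels:
  fixes A B C D :: complex
  assumes "A * w1 + B * w2 = 0" "C * w1 + D * w2 = 0" "A * z1 + C * z2 = 0" "B * z1 + D * z2 = 0"
    and "f * z1 * w1 + g * z1 * w2 + h * z2 * w1 + k * z2 * w2 = 0"
    and "z1 \<noteq> 0 \<or> z2 \<noteq> 0" "w1 \<noteq> 0 \<or> w2 \<noteq> 0"
  shows "A * D - B * C = 0" "f * D + A * k - g * C - B * h = 0"
proof -
  have "w1 * (A * D - B * C) = 0" "w2 * (A * D - B * C) = 0"
    using assms(1,2) by algebra+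
  then show "A * D - B * C = 0" using assms(7) by auto
  let ?p = "f * D + A * k - g * C - B * h"
  have "z1 * w1 * ?p = 0" using assms(1-5) by algebra
  moreover have "z1 * w2 * ?p = 0" using assms(1-5) by algebra
  moreover have "z2 * w1 * ?p = 0" using assms(1-5) by algebra
  moreover have "z2 * w2 * ?p = 0" using assms(1-5) by algebra
  ultimately show "?p = 0" using assms(6,7) by auto
qed

text \<open>Rows of the adjugate lie in the left kernel and columns in the right one, so a nonzero
  diagonal entry of the adjugate supplies both vectors.\<close>

lemma kernels_of_mixed_det:
  fixes A B C D :: complex
  assumes "A * D - B * C = 0" "f * D + A * k - g * C - B * h = 0" "f \<noteq> 0"
  shows "\<exists>z1 z2 w1 w2. (z1 \<noteq> 0 \<or> z2 \<noteq> 0) \<and> (w1 \<noteq> 0 \<or> w2 \<noteq> 0) \<and>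
    A * w1 + B * w2 = 0 \<and> C * w1 + D * w2 = 0 \<and> A * z1 + C * z2 = 0 \<and> B * z1 + D * z2 = 0 \<and>
    f * z1 * w1 + g * z1 * w2 + h * z2 * w1 + k * z2 * w2 = 0"
    (is "\<exists>z1 z2 w1 w2. ?P z1 z2 w1 w2")
proof -
  consider "D \<noteq> 0" | "A \<noteq> 0" | "A = 0" "D = 0" "B \<noteq> 0" | "A = 0" "D = 0" "C \<noteq> 0"
    | "A = 0" "D = 0" "B = 0" "C = 0" by blast
  then show ?thesis
  proof cases
    case 1
    have "f * D * D + g * D * (- C) + h * (- B) * D + k * (- B) * (- C) = 0"
      using assms(1,2) by algebra
    then have "?P D (- B) D (- C)" using 1 assms(1) by (simp add: algebra_simps)
    then show ?thesis by blast
  next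
    case 2
    have "f * (- C) * (- B) + g * (- C) * A + h * A * (- B) + k * A * A = 0"
      using assms(1,2) by algebra
    then have "?P (- C) A (- B) A" using 2 assms(1) by (simp add: algebra_simps)
    then show ?thesis by blast
  next
    case 3
    then have "?P 0 1 1 0" using assms by simp
    then show ?thesis by blast
  next
    case 4
    then have "?P 1 0 0 1" using assms by simp
    then show ?thesis by blast
  next
    \<comment> \<open>For the zero matrix every vector is a kernel vector, and any zero of F will
      do; \<open>f \<noteq> 0\<close> makes this choice of w nonzero.\<close>
    case 5
    then have "?P 1 0 (- g) f" using assms(3) by simp
    then show ?thesis by blast
  qed
qed

text \<open>The right-hand side says that \<open>det2 (S - t F)\<close> has a double root \<open>t\<close>; for it, \<open>w\<close> and \<open>z\<close> of a
  double zero lie in the right and left kernel of \<open>S - t F\<close>.\<close>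

lemma has_double_zero_iff:
  assumes "det2 F \<noteq> 0" "F $ 1 $ 1 \<noteq> 0"
  shows "has_double_zero F S \<longleftrightarrow> (mixed_det2 F S)\<^sup>2 = 4 * det2 F * det2 S"
proof
  assume "has_double_zero F S"
  then obtain z w where zw: "z \<noteq> 0" "w \<noteq> 0" "ev F z w = 0" "ev S z w = 0"
    and tan: "\<And>z' w'. ev F z' w + ev F z w' = 0 \<Longrightarrow> ev S z' w + ev S z w' = 0"
    unfolding has_double_zero_def by blast
  \<comment> \<open>(m1, m2, k1, k2) is the differential of F at (z, w), and (n1, n2, l1, l2) that
    of S.\<close>
  define m1 where "m1 = F $ 1 $ 1 * w $ 1 + F $ 1 $ 2 * w $ 2"
  define m2 where "m2 = F $ 2 $ 1 * w $ 1 + F $ 2 $ 2 * w $ 2"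
  define k1 where "k1 = F $ 1 $ 1 * z $ 1 + F $ 2 $ 1 * z $ 2"
  define k2 where "k2 = F $ 1 $ 2 * z $ 1 + F $ 2 $ 2 * z $ 2"
  define n1 where "n1 = S $ 1 $ 1 * w $ 1 + S $ 1 $ 2 * w $ 2"
  define n2 where "n2 = S $ 2 $ 1 * w $ 1 + S $ 2 $ 2 * w $ 2"
  define l1 where "l1 = S $ 1 $ 1 * z $ 1 + S $ 2 $ 1 * z $ 2"
  define l2 where "l2 = S $ 1 $ 2 * z $ 1 + S $ 2 $ 2 * z $ 2"
  have H: "x1 * n1 + x2 * n2 + y1 * l1 + y2 * l2 = 0" if "x1 * m1 + x2 * m2 + y1 * k1 + y2 * k2 = 0" for x1 x2 y1 y2
    using tan[of "vector [x1, x2]" "vector [y1, y2]"] that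
    unfolding m1_def m2_def k1_def k2_def n1_def n2_def l1_def l2_def by (simp add: ev_eq algebra_simps)
  have "m1 \<noteq> 0 \<or> m2 \<noteq> 0"
  proof (rule ccontr)
    assume "\<not> ?thesis"
    then have "w $ 1 * det2 F = 0" "w $ 2 * det2 F = 0"
      unfolding m1_def m2_def det2_def by (simp, algebra, simp, algebra)
    then show False using assms zw(2) by (simp add: vec2_eq_iff)
  qed
  \<comment> \<open>By \<open>H\<close> the differential of S vanishes on the kernel of that of F,
    hence is a multiple of it; a nonzero m1 or m2 provides the factor.\<close>
  then have "\<exists>t. n1 = t * m1 \<and> n2 = t * m2 \<and> l1 = t * k1 \<and> l2 = t * k2"
  proof
    assume m: "m1 \<noteq> 0"
    show ?thesis
      using H[of m2 "- m1" 0 0] H[of k1 0 "- m1" 0] H[of k2 0 0 "- m1"] m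
      by (intro exI[of _ "n1 / m1"]) (simp add: field_simps)
  next
    assume m: "m2 \<noteq> 0"
    show ?thesis
      using H[of m2 "- m1" 0 0] H[of 0 k1 "- m2" 0] H[of 0 k2 0 "- m2"] m
      by (intro exI[of _ "n2 / m2"]) (simp add: field_simps)
  qed
  then obtain t where t: "n1 = t * m1" "n2 = t * m2" "l1 = t * k1" "l2 = t * k2" by blast
  define A where "A = S $ 1 $ 1 - t * F $ 1 $ 1"
  define B where "B = S $ 1 $ 2 - t * F $ 1 $ 2"
  define C where "C = S $ 2 $ 1 - t * F $ 2 $ 1"
  define D where "D = S $ 2 $ 2 - t * F $ 2 $ 2"
  have S: "S $ 1 $ 1 = A + t * F $ 1 $ 1" "S $ 1 $ 2 = B + t * F $ 1 $ 2"
    "S $ 2 $ 1 = C + t * F $ 2 $ 1" "S $ 2 $ 2 = D + t * F $ 2 $ 2"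
    by (simp_all add: A_def B_def C_def D_def)
  have "A * w $ 1 + B * w $ 2 = 0" "C * w $ 1 + D * w $ 2 = 0" "A * z $ 1 + C * z $ 2 = 0" "B * z $ 1 + D * z $ 2 = 0"
    using t unfolding A_def B_def C_def D_def m1_def m2_def k1_def k2_def n1_def n2_def l1_def l2_def
    by (simp_all add: algebra_simps)
  from mixed_det_kernels[OF this zw(3)[unfolded ev_eq]] zw(1,2)
  have "A * D - B * C = 0" "F $ 1 $ 1 * D + A * F $ 2 $ 2 - F $ 1 $ 2 * C - B * F $ 2 $ 1 = 0"
    by (auto simp: vec2_eq_iff)
  then show "(mixed_det2 F S)\<^sup>2 = 4 * det2 F * det2 S"
    unfolding mixed_det2_def det2_def S by algebra
next
  assume disc: "(mixed_det2 F S)\<^sup>2 = 4 * det2 F * det2 S"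
  \<comment> \<open>The critical point of \<open>det2 (S - t F)\<close> as a quadratic in t; zero
    discriminant makes it the double root.\<close>
  define t where "t = mixed_det2 F S / (2 * det2 F)"
  have t: "mixed_det2 F S = 2 * t * det2 F" using assms by (simp add: t_def)
  have "t * t * det2 F * det2 F = det2 S * det2 F" using disc t by algebra
  then have dS: "det2 S = t * t * det2 F" using assms by simp
  define A where "A = S $ 1 $ 1 - t * F $ 1 $ 1"
  define B where "B = S $ 1 $ 2 - t * F $ 1 $ 2"
  define C where "C = S $ 2 $ 1 - t * F $ 2 $ 1"
  define D where "D = S $ 2 $ 2 - t * F $ 2 $ 2"
  have S: "S $ 1 $ 1 = A + t * F $ 1 $ 1" "S $ 1 $ 2 = B + t * F $ 1 $ 2"
    "S $ 2 $ 1 = C + t * F $ 2 $ 1" "S $ 2 $ 2 = D + t * F $ 2 $ 2"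
    by (simp_all add: A_def B_def C_def D_def)
  have mix: "F $ 1 $ 1 * D + A * F $ 2 $ 2 - F $ 1 $ 2 * C - B * F $ 2 $ 1 = 0"
    using t unfolding mixed_det2_def det2_def S by algebra
  have "A * D - B * C = 0"
    using dS mix unfolding det2_def S by algebra
  from kernels_of_mixed_det[OF this mix assms(2)] obtain z1 z2 w1 w2 where
    nz: "z1 \<noteq> 0 \<or> z2 \<noteq> 0" "w1 \<noteq> 0 \<or> w2 \<noteq> 0" and
    ker: "A * w1 + B * w2 = 0" "C * w1 + D * w2 = 0" "A * z1 + C * z2 = 0" "B * z1 + D * z2 = 0" and
    F0: "F $ 1 $ 1 * z1 * w1 + F $ 1 $ 2 * z1 * w2 + F $ 2 $ 1 * z2 * w1 + F $ 2 $ 2 * z2 * w2 = 0" by blast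
  define z :: "complex^2" where "z = vector [z1, z2]"
  define w :: "complex^2" where "w = vector [w1, w2]"
  have ev_S: "ev S z' w = t * ev F z' w" "ev S z w' = t * ev F z w'" for z' w'
    using ker unfolding ev_eq S z_def w_def vector_2 by algebra+
  have "ev F z w = 0" using F0 by (simp add: ev_eq z_def w_def)
  moreover have "ev S z' w + ev S z w' = 0" if "ev F z' w + ev F z w' = 0" for z' w'
    using that unfolding ev_S by (simp flip: distrib_left)
  moreover have "z \<noteq> 0" "w \<noteq> 0" using nz by (auto simp: z_def w_def vec2_eq_iff)
  ultimately show "has_double_zero F S"
    unfolding has_double_zero_def using ev_S(1) by (metis mult_zero_right)
qed

text \<open>With h = \<open>height x\<close>, the discriminant
  \<open>(mixed_det2 F S)\<^sup>2 - 4 * det2 F * det2 S\<close> equals \<open>4 h\<^sup>2\<close>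
  times the complex bilinear extension of the metric evaluated on v + i w, namely g(v,v) - g(w,w) +
  2 i g(v,w).\<close>

lemma hitchin_null_line_form: "hitchin_null paraboloid line_form hyp_metric"
  unfolding hitchin_null_def
proof (intro ballI allI)
  fix x v w assume x: "x \<in> paraboloid"
  define h where "h = height x"
  have h: "h > 0" using x by (simp add: mem_paraboloid h_def)
  define N where "N = normal_section line_form x v w"
  have dF: "det2 (line_form x) = - complex_of_real h"
    by (simp add: det2_def line_form_def form11_def of_real_height h_def)
  have dN: "det2 N = Complex (fst v \<bullet> fst v - fst w \<bullet> fst w) (2 * (fst v \<bullet> fst w))"
    by (simp add: det2_def N_def normal_section_line_form complex_eq_iff inner_complex_def algebra_simps)
  have m: "mixed_det2 (line_form x) N = - Complex (dheight x v) (dheight x w)"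
    by (simp add: mixed_det2_def N_def normal_section_line_form line_form_def form11_def complex_eq_iff inner_complex_def
        dheight_def algebra_simps)
  have "has_double_zero (line_form x) N \<longleftrightarrow> (mixed_det2 (line_form x) N)\<^sup>2 = 4 * det2 (line_form x) * det2 N"
    by (rule has_double_zero_iff) (use h dF in \<open>auto simp: line_form_def form11_def\<close>)
  also have "\<dots> \<longleftrightarrow> dheight x v * dheight x v + 4 * h * (fst v \<bullet> fst v)
      = dheight x w * dheight x w + 4 * h * (fst w \<bullet> fst w)
    \<and> dheight x v * dheight x w + 4 * h * (fst v \<bullet> fst w) = 0"
    unfolding m dF dN by (auto simp: complex_eq_iff power2_eq_square algebra_simps)
  also have "\<dots> \<longleftrightarrow> hyp_metric x v v = hyp_metric x w w \<and> hyp_metric x v w = 0"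
    using h by (auto simp: hyp_metric_eq h_def)
  finally show "hyp_metric x v v = hyp_metric x w w \<and> hyp_metric x v w = 0
      \<longleftrightarrow> has_double_zero (line_form x) (normal_section line_form x v w)"
    by (simp add: N_def)
qed

section \<open>Geodesics as lines through two points\<close>

text \<open>The point pairs are the solutions of \<open>\<alpha> \<zeta>\<^sup>2 + (\<beta> - a cnj \<alpha> + cnj a \<alpha>) \<zeta> + cnj a \<beta> - b cnj \<alpha> = 0\<close>,
  \<open>\<eta> = (\<alpha> \<zeta> + \<beta>) / cnj \<alpha>\<close>, where \<open>x = (a, b)\<close> and \<open>v = (\<alpha>, \<beta>)\<close>; the discriminant of the quadratic
  equation is \<open>4 (height x)\<^sup>2 hyp_metric x v v > 0\<close>.\<close>

lemma straight_line_common_points: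
  assumes x: "x \<in> paraboloid" and v: "v \<noteq> 0"
  shows "\<exists>p\<in>Q. \<exists>q\<in>Q. p \<noteq> q \<and> (\<forall>s. p \<in> curve (line_form (x + s *\<^sub>R v)) \<and> q \<in> curve (line_form (x + s *\<^sub>R v)))"
proof -
  \<comment> \<open>\<open>ev\<close> is affine along the segment, so common zeros of
    \<open>line_form x\<close> and \<open>dline_form v\<close> lie on every line of it.\<close>
  have *: ?thesis if "z \<noteq> 0" "w \<noteq> 0" "z' \<noteq> 0" "w' \<noteq> 0" "wedge z z' \<noteq> 0"
    "ev (line_form x) z w = 0" "ev (dline_form v) z w = 0" "ev (line_form x) z' w' = 0" "ev (dline_form v) z' w' = 0" for z w z' w'
  proof (intro bexI conjI allI)
    show "(hpt z, hpt w) \<noteq> (hpt z', hpt w')" using that by (simp add: hpt_eq_iff)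
    show "(hpt z, hpt w) \<in> curve (line_form (x + s *\<^sub>R v))" "(hpt z', hpt w') \<in> curve (line_form (x + s *\<^sub>R v))" for s
      using that by (simp_all add: mem_curve ev_line_form_add_scaleR)
    show "(hpt z, hpt w) \<in> Q" "(hpt z', hpt w') \<in> Q" using that by (auto simp: Q_def P1_def)
  qed
  define a where "a = fst x"
  define b where "b = complex_of_real (snd x)"
  define \<alpha> where "\<alpha> = fst v"
  define \<beta> where "\<beta> = complex_of_real (snd v)"
  have ev_x: "ev (line_form x) (vector [z1, z2]) (vector [w1, w2]) = z1 * w1 - a * z1 * w2 + cnj a * z2 * w1 - b * z2 * w2" for z1 z2 w1 w2
    by (simp add: ev_line_form a_def b_def)
  have ev_v: "ev (dline_form v) (vector [z1, z2]) (vector [w1, w2]) = - \<alpha> * z1 * w2 + cnj \<alpha> * z2 * w1 - \<beta> * z2 * w2" for z1 z2 w1 w2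
    by (simp add: ev_eq dline_form_def \<alpha>_def \<beta>_def)
  show ?thesis
  proof (cases "\<alpha> = 0")
    \<comment> \<open>Here only b varies, and the common points are those at infinity: (\<infinity>,
      a) and (- cnj a, \<infinity>).\<close>
    case True
    show ?thesis
      by (rule *[of "vector [1, 0]" "vector [a, 1]" "vector [- cnj a, 1]" "vector [1, 0]"])
        (auto simp: ev_x ev_v True vec2_eq_iff wedge_def)
  next
    case False
    define \<Delta> where "\<Delta> = (dheight x v)\<^sup>2 + 4 * height x * (\<alpha> \<bullet> \<alpha>)"
    have "4 * height x * (\<alpha> \<bullet> \<alpha>) > 0" using x False by (simp add: mem_paraboloid)
    then have "\<Delta> > 0" unfolding \<Delta>_def using zero_le_power2[of "dheight x v"] by linarith
    define r where "r = complex_of_real (sqrt \<Delta>)"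
    have r0: "r \<noteq> 0" using \<open>\<Delta> > 0\<close> by (simp add: r_def)
    have "r * r = complex_of_real \<Delta>" using \<open>\<Delta> > 0\<close> by (simp add: r_def flip: of_real_mult)
    also have "\<dots> = (\<beta> - a * cnj \<alpha> + cnj a * \<alpha>)\<^sup>2 - 4 * \<alpha> * (cnj a * \<beta> - b * cnj \<alpha>)"
    proof -
      have 1: "complex_of_real (dheight x v) = \<beta> - a * cnj \<alpha> - cnj a * \<alpha>"
        by (simp add: dheight_def \<beta>_def a_def \<alpha>_def complex_eq_iff inner_complex_def)
      have 2: "complex_of_real (\<alpha> \<bullet> \<alpha>) = \<alpha> * cnj \<alpha>"
        by (simp add: complex_eq_iff inner_complex_def)
      show ?thesis
        unfolding \<Delta>_def of_real_add of_real_mult of_real_power 1 2 of_real_height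
        by (simp add: a_def[symmetric] b_def[symmetric] power2_eq_square algebra_simps)
    qed
    finally have r: "r * r = (\<beta> - a * cnj \<alpha> + cnj a * \<alpha>)\<^sup>2 - 4 * \<alpha> * (cnj a * \<beta> - b * cnj \<alpha>)" .
    define \<zeta> where "\<zeta> e = (- (\<beta> - a * cnj \<alpha> + cnj a * \<alpha>) + e * r) / (2 * \<alpha>)" for e
    define \<eta> where "\<eta> e = (\<alpha> * \<zeta> e + \<beta>) / cnj \<alpha>" for e
    have \<eta>: "cnj \<alpha> * \<eta> e = \<alpha> * \<zeta> e + \<beta>" for e using False by (simp add: \<eta>_def)
    have \<zeta>: "2 * \<alpha> * \<zeta> e = - (\<beta> - a * cnj \<alpha> + cnj a * \<alpha>) + e * r" for e using False by (simp add: \<zeta>_def)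
    have quad: "\<zeta> e * \<eta> e - a * \<zeta> e + cnj a * \<eta> e - b = 0" if e: "e * e = 1" for e
    proof -
      have "4 * \<alpha> * cnj \<alpha> * (\<zeta> e * \<eta> e - a * \<zeta> e + cnj a * \<eta> e - b) = 0"
        using \<eta>[of e] \<zeta>[of e] r e by algebra
      then show ?thesis using False by simp
    qed
    have "\<zeta> 1 \<noteq> \<zeta> (- 1)" using r0 False by (auto simp: \<zeta>_def)
    then show ?thesis
      using quad[of 1] quad[of "- 1"] \<eta>[of 1] \<eta>[of "- 1"]
      by (intro *[of "vector [\<zeta> 1, 1]" "vector [\<eta> 1, 1]" "vector [\<zeta> (- 1), 1]" "vector [\<eta> (- 1), 1]"])
        (simp_all add: ev_x ev_v vec2_eq_iff wedge_def)
  qed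
qed

text \<open>A point with \<open>\<eta> = - cnj \<zeta>\<close> would be real for the twisted structure, and lies on no line of the
  family; for any other point the complex equation of incidence amounts to two real ones.\<close>

lemma incidence_kernel:
  assumes x: "x \<in> paraboloid" and z: "z \<noteq> 0" and w: "w \<noteq> 0" and inc: "ev (line_form x) z w = 0"
    and v: "ev (dline_form v) z w = 0" "v \<noteq> 0" and v': "ev (dline_form v') z w = 0"
  shows "\<exists>k. v' = k *\<^sub>R v"
proof -
  have ev_d: "ev (dline_form u) z w = - fst u * z $ 1 * w $ 2 + cnj (fst u) * z $ 2 * w $ 1 - complex_of_real (snd u) * z $ 2 * w $ 2" for u
    by (simp add: ev_eq dline_form_def)
  have vertical: ?thesis if "fst v = 0" "fst v' = 0"
  proof -
    have "snd v \<noteq> 0" using v(2) that by (simp add: prod_eq_iff)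
    then show ?thesis using that by (intro exI[of _ "snd v' / snd v"]) (simp add: prod_eq_iff)
  qed
  \<comment> \<open>If a coordinate of the point is infinite, the linearised equation reduces to
    \<open>fst = 0\<close> and only the b-direction is left.\<close>
  consider "z $ 2 = 0" | "z $ 2 \<noteq> 0" "w $ 2 = 0" | "z $ 2 \<noteq> 0" "w $ 2 \<noteq> 0" by blast
  then show ?thesis
  proof cases
    case 1
    then have "z $ 1 \<noteq> 0" using z by (simp add: vec2_eq_iff)
    then have "w $ 2 \<noteq> 0" using inc w 1 by (auto simp: ev_line_form vec2_eq_iff)
    then show ?thesis using vertical v(1) v' 1 \<open>z $ 1 \<noteq> 0\<close> by (simp add: ev_d)
  next
    case 2
    then have "w $ 1 \<noteq> 0" using w by (simp add: vec2_eq_iff)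
    then show ?thesis using vertical v(1) v' 2 by (simp add: ev_d)
  next
    case 3
    define \<zeta> where "\<zeta> = z $ 1 / z $ 2"
    define \<eta> where "\<eta> = w $ 1 / w $ 2"
    have zw: "z $ 1 = \<zeta> * z $ 2" "w $ 1 = \<eta> * w $ 2" using 3 by (simp_all add: \<zeta>_def \<eta>_def)
    have "z $ 2 * w $ 2 * (\<zeta> * \<eta> - fst x * \<zeta> + cnj (fst x) * \<eta> - complex_of_real (snd x)) = 0"
      using inc unfolding ev_line_form zw by (simp add: algebra_simps)
    then have inc': "\<zeta> * \<eta> - fst x * \<zeta> + cnj (fst x) * \<eta> - complex_of_real (snd x) = 0" using 3 by simp
    have ker: "cnj (fst u) * \<eta> - fst u * \<zeta> = complex_of_real (snd u)" if "ev (dline_form u) z w = 0" for u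
    proof -
      have "z $ 2 * w $ 2 * (cnj (fst u) * \<eta> - fst u * \<zeta> - complex_of_real (snd u)) = 0"
        using that unfolding ev_d zw by (simp add: algebra_simps)
      then show ?thesis using 3 by simp
    qed
    define d where "d = \<eta> + cnj \<zeta>"
    have "d \<noteq> 0"
    proof
      assume "d = 0"
      then have \<eta>: "\<eta> = - cnj \<zeta>" by (simp add: d_def eq_neg_iff_add_eq_0)
      \<comment> \<open>Completing the square: the incidence equation would make a squared modulus
        equal to the negative number \<open>- height x\<close>.\<close>
      have "(\<zeta> + cnj (fst x)) * cnj (\<zeta> + cnj (fst x)) = - complex_of_real (height x)"
        using inc' unfolding \<eta> of_real_height complex_cnj_add complex_cnj_cnj by algebra
      then have "complex_of_real ((cmod (\<zeta> + cnj (fst x)))\<^sup>2) = complex_of_real (- height x)"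
        by (simp only: complex_norm_square of_real_minus)
      then have "(cmod (\<zeta> + cnj (fst x)))\<^sup>2 = - height x" by (simp only: of_real_eq_iff)
      then show False using x zero_le_power2[of "cmod (\<zeta> + cnj (fst x))"] by (simp add: mem_paraboloid)
    qed
    \<comment> \<open>A real right-hand side in \<open>ker\<close> forces the imaginary part of
      \<open>cnj (fst u) * d\<close> to vanish, so \<open>fst u\<close> is a real multiple of
      d.\<close>
    have parallel: "fst u = complex_of_real ((fst u \<bullet> d) / (d \<bullet> d)) * d" if "ev (dline_form u) z w = 0" for u
    proof -
      have "Im (cnj (fst u) * \<eta> - fst u * \<zeta>) = 0" using ker[OF that] by simp
      then have "Re (fst u) * Im d - Im (fst u) * Re d = 0" by (simp add: d_def algebra_simps)
      then have "complex_of_real (d \<bullet> d) * fst u = complex_of_real (fst u \<bullet> d) * d"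
        by (simp add: complex_eq_iff inner_complex_def) algebra
      then show ?thesis using \<open>d \<noteq> 0\<close> by (simp add: field_simps)
    qed
    have rv: "fst v \<bullet> d \<noteq> 0"
    proof
      assume "fst v \<bullet> d = 0"
      then have "fst v = 0" using parallel[OF v(1)] by simp
      then show False using ker[OF v(1)] v(2) by (simp add: prod_eq_iff)
    qed
    define k where "k = (fst v' \<bullet> d) / (fst v \<bullet> d)"
    have "fst v' = complex_of_real k * fst v"
      by (subst parallel[OF v'], subst parallel[OF v(1)]) (use rv in \<open>simp add: k_def\<close>)
    moreover from this have "complex_of_real (snd v') = complex_of_real (k * snd v)"
      unfolding ker[OF v', symmetric] of_real_mult ker[OF v(1), symmetric] by (simp add: algebra_simps)
    then have "snd v' = k * snd v" by (simp only: of_real_eq_iff)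
    ultimately show ?thesis by (intro exI[of _ k]) (simp add: prod_eq_iff scaleR_conv_of_real)
  qed
qed

text \<open>The unit tangent \<open>\<gamma>' / |\<gamma>'|\<close> is constant.\<close>

lemma pregeodesic_straight:
  fixes \<gamma> \<gamma>' \<gamma>'' :: "real \<Rightarrow> 'a::real_inner"
  assumes "\<And>t. t \<in> {l<..<r} \<Longrightarrow> (\<gamma> has_vector_derivative \<gamma>' t) (at t)"
    "\<And>t. t \<in> {l<..<r} \<Longrightarrow> (\<gamma>' has_vector_derivative \<gamma>'' t) (at t)"
    "\<And>t. t \<in> {l<..<r} \<Longrightarrow> \<gamma>' t \<noteq> 0"
    "\<And>t. t \<in> {l<..<r} \<Longrightarrow> \<exists>k. \<gamma>'' t = k *\<^sub>R \<gamma>' t"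
    and "t0 \<in> {l<..<r}"
  shows "\<exists>e s. e \<noteq> 0 \<and> (\<forall>t\<in>{l<..<r}. \<gamma> t = \<gamma> t0 + s t *\<^sub>R e)"
proof -
  define n where "n t = sqrt (\<gamma>' t \<bullet> \<gamma>' t)" for t
  have n: "n t > 0" "n t * n t = \<gamma>' t \<bullet> \<gamma>' t" if "t \<in> {l<..<r}" for t
    using assms(3)[OF that] by (simp_all add: n_def)
  have "((\<lambda>t. inverse (n t) *\<^sub>R \<gamma>' t) has_vector_derivative 0) (at t)" if t: "t \<in> {l<..<r}" for t
  proof -
    obtain k where k: "\<gamma>'' t = k *\<^sub>R \<gamma>' t" using assms(4)[OF t] by blast
    have "((\<lambda>t. \<gamma>' t \<bullet> \<gamma>' t) has_real_derivative \<gamma>' t \<bullet> \<gamma>'' t + \<gamma>'' t \<bullet> \<gamma>' t) (at t)"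
      unfolding has_real_derivative_iff_has_vector_derivative
      by (rule bounded_bilinear.has_vector_derivative[OF bounded_bilinear_inner assms(2)[OF t] assms(2)[OF t]])
    from DERIV_chain2[OF DERIV_real_sqrt this] have
      "(n has_real_derivative inverse (n t) / 2 * (\<gamma>' t \<bullet> \<gamma>'' t + \<gamma>'' t \<bullet> \<gamma>' t)) (at t)"
      using assms(3)[OF t] by (simp add: n_def[abs_def])
    also have "inverse (n t) / 2 * (\<gamma>' t \<bullet> \<gamma>'' t + \<gamma>'' t \<bullet> \<gamma>' t) = k * n t"
      using n(1)[OF t] by (simp add: k field_simps flip: n(2)[OF t])
    finally have "(n has_real_derivative k * n t) (at t)" .
    from DERIV_inverse'[OF this] have "((\<lambda>t. inverse (n t)) has_real_derivative - (k / n t)) (at t)"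
      using n[OF t] by (simp add: field_simps)
    from has_vector_derivative_scaleR[OF this assms(2)[OF t]] show ?thesis
      by (simp add: k divide_inverse mult.commute)
  qed
  then have "\<exists>e. \<forall>t\<in>{l<..<r}. inverse (n t) *\<^sub>R \<gamma>' t = e"
    by (rule has_vector_derivative_zero_constant[OF convex_real_interval(8) has_vector_derivative_at_within]) blast+
  then obtain e where e: "\<And>t. t \<in> {l<..<r} \<Longrightarrow> inverse (n t) *\<^sub>R \<gamma>' t = e" by blast
  have \<gamma>': "\<gamma>' t = n t *\<^sub>R e" if "t \<in> {l<..<r}" for t
    using n[OF that] by (simp add: e[OF that, symmetric])
  have ee: "e \<bullet> e = 1"
    using n(1)[OF assms(5)] by (simp add: e[OF assms(5), symmetric] field_simps flip: n(2)[OF assms(5)])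
  \<comment> \<open>Since the velocity is along e, the component of \<gamma> orthogonal to e is
    constant; its e-component supplies the parameter s.\<close>
  have "((\<lambda>t. \<gamma> t - (\<gamma> t \<bullet> e) *\<^sub>R e) has_vector_derivative 0) (at t)" if t: "t \<in> {l<..<r}" for t
  proof -
    have "((\<lambda>t. \<gamma> t - (\<gamma> t \<bullet> e) *\<^sub>R e) has_vector_derivative (\<gamma>' t - (\<gamma>' t \<bullet> e) *\<^sub>R e)) (at t)"
      by (intro has_vector_derivative_diff assms(1)[OF t]
          bounded_linear.has_vector_derivative[OF bounded_linear_scaleR_left]
          bounded_linear.has_vector_derivative[OF bounded_linear_inner_left])
    then show ?thesis by (simp add: \<gamma>'[OF t] ee)
  qed
  then have "\<exists>c. \<forall>t\<in>{l<..<r}. \<gamma> t - (\<gamma> t \<bullet> e) *\<^sub>R e = c"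
    by (rule has_vector_derivative_zero_constant[OF convex_real_interval(8) has_vector_derivative_at_within]) blast+
  then obtain c where c: "\<And>t. t \<in> {l<..<r} \<Longrightarrow> \<gamma> t - (\<gamma> t \<bullet> e) *\<^sub>R e = c" by blast
  have "\<gamma> t = \<gamma> t0 + (\<gamma> t \<bullet> e - \<gamma> t0 \<bullet> e) *\<^sub>R e" if "t \<in> {l<..<r}" for t
  proof -
    have "\<gamma> t0 + (\<gamma> t \<bullet> e - \<gamma> t0 \<bullet> e) *\<^sub>R e = (\<gamma> t0 - (\<gamma> t0 \<bullet> e) *\<^sub>R e) + (\<gamma> t \<bullet> e) *\<^sub>R e"
      by (simp add: scaleR_left_diff_distrib)
    also have "\<dots> = \<gamma> t"
      unfolding c[OF assms(5)] c[OF that, symmetric] by simp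
    finally show ?thesis by (rule sym)
  qed
  moreover have "e \<noteq> 0" using ee by auto
  ultimately show ?thesis
    by (intro exI[of _ e] exI[of _ "\<lambda>t. \<gamma> t \<bullet> e - \<gamma> t0 \<bullet> e"] conjI ballI)
qed

lemma vector_derivative_of_zero:
  assumes "t \<in> {l<..<r}" "\<And>s. s \<in> {l<..<r} \<Longrightarrow> f s = (0 :: 'a::real_normed_vector)" "(f has_vector_derivative f') (at t)"
  shows "f' = 0"
proof -
  have "((\<lambda>_. 0) has_vector_derivative f') (at t)"
    by (rule has_vector_derivative_transform_within_open[OF assms(3), of "{l<..<r}"]) (use assms in auto)
  then show ?thesis using vector_derivative_unique_at has_vector_derivative_const by blast
qed

lemma linear_ev_dline_form: "linear (\<lambda>v. ev (dline_form v) z w)"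
  by (rule linearI) (simp_all add: ev_eq dline_form_def scaleR_conv_of_real algebra_simps)

lemma ev_line_form_affine: "ev (line_form x) z w = ev (line_form 0) z w + ev (dline_form x) z w"
  using ev_line_form_add_scaleR[of 0 1 x] by simp

lemma hyp_conn_diag: "hyp_conn x v v = (- dheight x v / height x) *\<^sub>R v"
  by (simp add: hyp_conn_def flip: scaleR_2)

lemma hitchin_geodesic_line_form: "hitchin_geodesic paraboloid line_form hyp_conn"
  unfolding hitchin_geodesic_def
proof (intro allI impI)
  fix l r :: real and \<gamma> \<gamma>' \<gamma>'' :: "real \<Rightarrow> E3"
  assume lr: "l < r"
    and "\<forall>t\<in>{l<..<r}. \<gamma> t \<in> paraboloid \<and> (\<gamma> has_vector_derivative \<gamma>' t) (at t) \<and>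
      (\<gamma>' has_vector_derivative \<gamma>'' t) (at t) \<and> \<gamma>' t \<noteq> 0"
  then have \<gamma>: "\<gamma> t \<in> paraboloid" "(\<gamma> has_vector_derivative \<gamma>' t) (at t)"
    "(\<gamma>' has_vector_derivative \<gamma>'' t) (at t)" "\<gamma>' t \<noteq> 0" if "t \<in> {l<..<r}" for t
    using that by blast+
  \<comment> \<open>On equal arguments \<open>hyp_conn\<close> is a multiple of the argument, so it
    is absorbed in k and the flat equation remains.\<close>
  have pre: "(\<exists>k. \<gamma>'' t + hyp_conn (\<gamma> t) (\<gamma>' t) (\<gamma>' t) = k *\<^sub>R \<gamma>' t) \<longleftrightarrow> (\<exists>k. \<gamma>'' t = k *\<^sub>R \<gamma>' t)" for t
    unfolding hyp_conn_diag
  proof (intro iffI; elim exE)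
    fix k assume "\<gamma>'' t + (- dheight (\<gamma> t) (\<gamma>' t) / height (\<gamma> t)) *\<^sub>R \<gamma>' t = k *\<^sub>R \<gamma>' t"
    then have "\<gamma>'' t = (k - - dheight (\<gamma> t) (\<gamma>' t) / height (\<gamma> t)) *\<^sub>R \<gamma>' t"
      by (simp only: scaleR_left_diff_distrib eq_diff_eq)
    then show "\<exists>k. \<gamma>'' t = k *\<^sub>R \<gamma>' t" by blast
  next
    fix k assume "\<gamma>'' t = k *\<^sub>R \<gamma>' t"
    then have "\<gamma>'' t + (- dheight (\<gamma> t) (\<gamma>' t) / height (\<gamma> t)) *\<^sub>R \<gamma>' t
        = (k + - dheight (\<gamma> t) (\<gamma>' t) / height (\<gamma> t)) *\<^sub>R \<gamma>' t"
      by (simp only: scaleR_left_distrib)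
    then show "\<exists>k. \<gamma>'' t + (- dheight (\<gamma> t) (\<gamma>' t) / height (\<gamma> t)) *\<^sub>R \<gamma>' t = k *\<^sub>R \<gamma>' t" by blast
  qed
  define t0 where "t0 = (l + r) / 2"
  have t0: "t0 \<in> {l<..<r}" using lr by (simp add: t0_def)
  show "(\<forall>t\<in>{l<..<r}. \<exists>k. \<gamma>'' t + hyp_conn (\<gamma> t) (\<gamma>' t) (\<gamma>' t) = k *\<^sub>R \<gamma>' t) \<longleftrightarrow>
      (\<exists>p\<in>Q. \<exists>q\<in>Q. p \<noteq> q \<and> (\<forall>t\<in>{l<..<r}. p \<in> curve (line_form (\<gamma> t)) \<and> q \<in> curve (line_form (\<gamma> t))))"
    unfolding pre
  proof
    assume "\<forall>t\<in>{l<..<r}. \<exists>k. \<gamma>'' t = k *\<^sub>R \<gamma>' t"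
    then obtain e s where e: "e \<noteq> 0" "\<And>t. t \<in> {l<..<r} \<Longrightarrow> \<gamma> t = \<gamma> t0 + s t *\<^sub>R e"
      using pregeodesic_straight[of l r \<gamma> \<gamma>' \<gamma>'' t0, OF \<gamma>(2) \<gamma>(3) \<gamma>(4) _ t0] by blast
    obtain p q where "p \<in> Q" "q \<in> Q" "p \<noteq> q"
      and pq: "\<And>s. p \<in> curve (line_form (\<gamma> t0 + s *\<^sub>R e)) \<and> q \<in> curve (line_form (\<gamma> t0 + s *\<^sub>R e))"
      using straight_line_common_points[OF \<gamma>(1)[OF t0] e(1)] by blast
    moreover have "p \<in> curve (line_form (\<gamma> t)) \<and> q \<in> curve (line_form (\<gamma> t))" if "t \<in> {l<..<r}" for t
      using pq[of "s t"] by (simp only: e(2)[OF that, symmetric])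
    ultimately show "\<exists>p\<in>Q. \<exists>q\<in>Q. p \<noteq> q \<and> (\<forall>t\<in>{l<..<r}. p \<in> curve (line_form (\<gamma> t)) \<and> q \<in> curve (line_form (\<gamma> t)))"
      by blast
  next
    assume "\<exists>p\<in>Q. \<exists>q\<in>Q. p \<noteq> q \<and> (\<forall>t\<in>{l<..<r}. p \<in> curve (line_form (\<gamma> t)) \<and> q \<in> curve (line_form (\<gamma> t)))"
    \<comment> \<open>Differentiating incidence with p twice puts both \<gamma>' and \<gamma>''
      among the real solutions of the linearised equation, all of which
      \<open>incidence_kernel\<close> shows to be multiples of the nonzero \<gamma>'.\<close>
    then obtain p where "p \<in> Q" and p: "\<And>t. t \<in> {l<..<r} \<Longrightarrow> p \<in> curve (line_form (\<gamma> t))" by blast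
    then obtain z w where zw: "z \<noteq> 0" "w \<noteq> 0" "p = (hpt z, hpt w)" by (auto simp: Q_def P1_def)
    have inc: "ev (line_form (\<gamma> t)) z w = 0" if "t \<in> {l<..<r}" for t
      using p[OF that] zw by (simp add: mem_curve)
    have bl: "bounded_linear (\<lambda>v. ev (dline_form v) z w)"
      using linear_ev_dline_form by (simp add: linear_conv_bounded_linear)
    have d1: "ev (dline_form (\<gamma>' t)) z w = 0" if t: "t \<in> {l<..<r}" for t
    proof (rule vector_derivative_of_zero[OF t inc])
      have "((\<lambda>t. ev (line_form 0) z w + ev (dline_form (\<gamma> t)) z w) has_vector_derivative (0 + ev (dline_form (\<gamma>' t)) z w)) (at t)"
        by (intro has_vector_derivative_add has_vector_derivative_const
            bounded_linear.has_vector_derivative[OF bl] \<gamma>(2)[OF t])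
      then show "((\<lambda>t. ev (line_form (\<gamma> t)) z w) has_vector_derivative ev (dline_form (\<gamma>' t)) z w) (at t)"
        by (simp flip: ev_line_form_affine)
    qed
    have d2: "ev (dline_form (\<gamma>'' t)) z w = 0" if t: "t \<in> {l<..<r}" for t
      by (rule vector_derivative_of_zero[OF t d1 bounded_linear.has_vector_derivative[OF bl \<gamma>(3)[OF t]]])
    show "\<forall>t\<in>{l<..<r}. \<exists>k. \<gamma>'' t = k *\<^sub>R \<gamma>' t"
      using incidence_kernel[OF \<gamma>(1) zw(1,2) inc d1 \<gamma>(4) d2] by blast
  qed
qed

text \<open>The segment through x in direction v has zero second derivative and is a Hitchin
  geodesic by \<open>straight_line_common_points\<close>; its geodesic equation at x leaves only the
  Christoffel term.\<close>

lemma projective_of_hitchin_geodesic: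
  assumes "hitchin_geodesic paraboloid line_form \<Gamma>" "connection_on paraboloid \<Gamma>" "x \<in> paraboloid"
  shows "\<exists>k. \<Gamma> x v v = k *\<^sub>R v"
proof (cases "v = 0")
  case True
  have "bilinear (\<Gamma> x)" using assms(2,3) unfolding connection_on_def by blast
  then show ?thesis using True by (simp add: bilinear_lzero)
next
  case False
  define \<gamma> where "\<gamma> t = x + t *\<^sub>R v" for t :: real
  have "open (\<gamma> -` paraboloid)"
    by (intro open_vimage open_paraboloid) (auto simp: \<gamma>_def intro!: continuous_intros)
  moreover have "0 \<in> \<gamma> -` paraboloid" using assms(3) by (simp add: \<gamma>_def)
  ultimately obtain e where e: "e > 0" "ball 0 e \<subseteq> \<gamma> -` paraboloid"
    by (meson open_contains_ball)
  have "\<gamma> t \<in> paraboloid \<and> (\<gamma> has_vector_derivative v) (at t) \<and>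
      ((\<lambda>_. v) has_vector_derivative 0) (at t) \<and> v \<noteq> 0" if "t \<in> {- e<..<e}" for t
  proof -
    have "t \<in> ball 0 e" using that by (auto simp: dist_real_def)
    then have "\<gamma> t \<in> paraboloid" using e(2) by blast
    moreover have "((\<lambda>t. x + t *\<^sub>R v) has_vector_derivative (0 + 1 *\<^sub>R v)) (at t)"
      by (auto intro!: derivative_eq_intros)
    ultimately show ?thesis using False by (simp add: \<gamma>_def[abs_def])
  qed
  then have iff: "(\<forall>t\<in>{- e<..<e}. \<exists>k. 0 + \<Gamma> (\<gamma> t) v v = k *\<^sub>R v) \<longleftrightarrow>
      (\<exists>p\<in>Q. \<exists>q\<in>Q. p \<noteq> q \<and> (\<forall>t\<in>{- e<..<e}. p \<in> curve (line_form (\<gamma> t)) \<and> q \<in> curve (line_form (\<gamma> t))))"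
    using assms(1)[unfolded hitchin_geodesic_def, rule_format, of "- e" e \<gamma> "\<lambda>_. v" "\<lambda>_. 0"] e(1) by simp
  have "\<forall>t\<in>{- e<..<e}. \<exists>k. 0 + \<Gamma> (\<gamma> t) v v = k *\<^sub>R v"
  proof (rule iffD2[OF iff])
    show "\<exists>p\<in>Q. \<exists>q\<in>Q. p \<noteq> q \<and> (\<forall>t\<in>{- e<..<e}. p \<in> curve (line_form (\<gamma> t)) \<and> q \<in> curve (line_form (\<gamma> t)))"
      unfolding \<gamma>_def using straight_line_common_points[OF assms(3) False] by blast
  qed
  then have "\<exists>k. 0 + \<Gamma> (\<gamma> 0) v v = k *\<^sub>R v" using e(1) by simp
  then show ?thesis by (simp add: \<gamma>_def)
qed

lemma determines_EW_line_form: "determines_EW paraboloid line_form hyp_metric hyp_conn"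
proof -
  have "same_EW paraboloid hyp_metric hyp_conn g' \<Gamma>'"
    if "einstein_weyl paraboloid g' \<Gamma>'" "hitchin_null paraboloid line_form g'" "hitchin_geodesic paraboloid line_form \<Gamma>'" for g' \<Gamma>'
  proof (rule same_EW_unique[OF open_paraboloid einstein_weyl_hyp that(1) hitchin_null_line_form that(2)])
    fix x v assume x: "x \<in> paraboloid"
    have "connection_on paraboloid \<Gamma>'" using that(1) by (simp add: einstein_weyl_def)
    from projective_of_hitchin_geodesic[OF that(3) this x]
    obtain k where "\<Gamma>' x v v = k *\<^sub>R v" by blast
    then have "\<Gamma>' x v v - hyp_conn x v v = (k - - dheight x v / height x) *\<^sub>R v"
      by (simp only: hyp_conn_diag scaleR_left_diff_distrib)
    then show "\<exists>k. \<Gamma>' x v v - hyp_conn x v v = k *\<^sub>R v" by blast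
  qed
  then show ?thesis
    unfolding determines_EW_def
    using complete_family_line_form einstein_weyl_hyp hitchin_null_line_form hitchin_geodesic_line_form by blast
qed

section \<open>The rotation actions\<close>

text \<open>With arbitrary angles, powers and inverses of \<open>Rot\<close> become single rotations
  and composition becomes addition.\<close>

definition qrot :: "real \<Rightarrow> qpoint \<Rightarrow> qpoint" where
  "qrot \<theta> x = ((\<lambda>z. vector [cis \<theta> * z $ 1, z $ 2]) ` fst x, (\<lambda>w. vector [cis (- \<theta>) * w $ 1, w $ 2]) ` snd x)"

definition erot :: "real \<Rightarrow> E3 \<Rightarrow> E3" where
  "erot \<theta> x = (cis \<theta> * fst x, snd x)"

lemma qrot_qrot: "qrot \<theta> (qrot \<phi> x) = qrot (\<theta> + \<phi>) x"
  by (simp add: qrot_def image_image cis_mult flip: mult.assoc)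

lemma erot_erot: "erot \<theta> (erot \<phi> x) = erot (\<theta> + \<phi>) x"
  by (simp add: erot_def cis_mult flip: mult.assoc)

lemma vector_id2: "vector [z $ 1, z $ 2] = z" for z :: "'a::zero^2"
  by (simp add: vec2_eq_iff)

lemma qrot_0 [simp]: "qrot 0 x = x"
  by (simp add: qrot_def vector_id2)

lemma erot_0 [simp]: "erot 0 x = x"
  by (simp add: erot_def)

lemma Rot_funpow: "(Rot n ^^ k) x = qrot (2 * pi * real k / real n) x"
proof (induction k)
  case (Suc k)
  have "Rot n = qrot (2 * pi / real n)" by (simp add: fun_eq_iff Rot_def qrot_def)
  then have "(Rot n ^^ Suc k) x = qrot (2 * pi / real n) ((Rot n ^^ k) x)" by simp
  then show ?case unfolding Suc.IH by (simp add: qrot_qrot add_divide_distrib distrib_left)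
qed simp

lemma hyp_rot_funpow: "(hyp_rot n ^^ k) x = erot (- (2 * pi * real k / real n)) x"
proof (induction k)
  case (Suc k)
  have "hyp_rot n = erot (- (2 * pi / real n))" by (simp add: fun_eq_iff hyp_rot_def erot_def)
  then have "(hyp_rot n ^^ Suc k) x = erot (- (2 * pi / real n)) ((hyp_rot n ^^ k) x)" by simp
  then show ?case unfolding Suc.IH by (simp add: erot_erot add_divide_distrib distrib_left)
qed simp

lemma cis_minus_2pi: "cis (- (2 * pi)) = 1"
  by (simp add: complex_eq_iff)

lemma Rot_period: "n > 0 \<Longrightarrow> (Rot n ^^ n) x = x"
  by (simp add: Rot_funpow qrot_def vector_id2 cis_minus_2pi)

lemma hyp_rot_period: "n > 0 \<Longrightarrow> (hyp_rot n ^^ n) x = x"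
  by (simp add: hyp_rot_funpow erot_def cis_minus_2pi)

text \<open>The orbits consist of nonnegative powers only; periodicity supplies the inverse of
  \<open>f ^^ k\<close> as \<open>f ^^ (n - k)\<close>.\<close>

lemma cyclic_orbit_eq_iff:
  assumes "n > 0" "\<And>x. (f ^^ n) x = x"
  shows "{(f ^^ k) x | k. True} = {(f ^^ k) y | k. True} \<longleftrightarrow> (\<exists>k<n. y = (f ^^ k) x)"
proof
  assume "{(f ^^ k) x | k. True} = {(f ^^ k) y | k. True}"
  moreover have "(f ^^ 0) y \<in> {(f ^^ k) y | k. True}" by blast
  ultimately obtain k where "(f ^^ 0) y = (f ^^ k) x" by blast
  then have "y = (f ^^ (k mod n)) x" using funpow_mod_eq[OF assms(2)] by simp
  then show "\<exists>k<n. y = (f ^^ k) x" using assms(1) by (metis mod_less_divisor)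
next
  assume "\<exists>k<n. y = (f ^^ k) x"
  then obtain k where k: "k < n" "y = (f ^^ k) x" by blast
  have x: "x = (f ^^ (n - k)) y"
    using k assms(2)[of x] by (simp flip: funpow_add[THEN fun_cong, simplified])
  have "(f ^^ j) y = (f ^^ (j + k)) x" "(f ^^ j) x = (f ^^ (j + (n - k))) y" for j
    using k(2) x by (simp_all add: funpow_add)
  then show "{(f ^^ k) x | k. True} = {(f ^^ k) y | k. True}" by blast
qed

lemma Phi_eq_iff: "n > 0 \<Longrightarrow> Phi n x = Phi n y \<longleftrightarrow> (\<exists>k<n. y = (Rot n ^^ k) x)"
  unfolding Phi_def by (rule cyclic_orbit_eq_iff) (simp_all add: Rot_period)

lemma hyp_orbit_eq_iff: "n > 0 \<Longrightarrow> hyp_orbit n x = hyp_orbit n y \<longleftrightarrow> (\<exists>k<n. y = (hyp_rot n ^^ k) x)"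
  unfolding hyp_orbit_def by (rule cyclic_orbit_eq_iff) (simp_all add: hyp_rot_period)

lemma hpt_image: "hpt z = (\<lambda>c. c *s z) ` {c. c \<noteq> 0}"
  by (auto simp: hpt_def)

lemma diag_image_hpt: "(\<lambda>z. vector [c * z $ 1, z $ 2]) ` hpt z = hpt (vector [c * z $ 1, z $ 2])"
proof -
  have *: "(vector [c * (d *s z) $ 1, (d *s z) $ 2] :: complex^2) = d *s vector [c * z $ 1, z $ 2]" for d
    by (simp add: vec2_eq_iff)
  show ?thesis by (simp only: hpt_image image_image *)
qed

lemma qrot_hpt:
  "qrot \<theta> (hpt z, hpt w) = (hpt (vector [cis \<theta> * z $ 1, z $ 2]), hpt (vector [cis (- \<theta>) * w $ 1, w $ 2]))"
  by (simp add: qrot_def diag_image_hpt)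

lemma qrot_curve_line_form: "qrot \<theta> ` curve (line_form x) = curve (line_form (erot (- \<theta>) x))"
proof -
  \<comment> \<open>Proved for all angles and parameters, so that the reverse inclusion follows from
    the inverse rotation.\<close>
  have sub: "qrot \<theta> ` curve (line_form x) \<subseteq> curve (line_form (erot (- \<theta>) x))" for \<theta> x
  proof
    fix p assume "p \<in> qrot \<theta> ` curve (line_form x)"
    then obtain z w where zw: "z \<noteq> 0" "w \<noteq> 0" "ev (line_form x) z w = 0" "p = qrot \<theta> (hpt z, hpt w)"
      by (auto simp: curve_def)
    define z' :: "complex^2" where "z' = vector [cis \<theta> * z $ 1, z $ 2]"
    define w' :: "complex^2" where "w' = vector [cis (- \<theta>) * w $ 1, w $ 2]"
    have nz: "z' \<noteq> 0" "w' \<noteq> 0" using zw by (auto simp: z'_def w'_def vec2_eq_iff)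
    have c: "cis \<theta> * cis (- \<theta>) = 1" by (simp add: cis_mult)
    have "ev (line_form (erot (- \<theta>) x)) z' w' = ev (line_form x) z w"
      unfolding ev_line_form erot_def z'_def w'_def vector_2 fst_conv snd_conv complex_cnj_mult cis_cnj minus_minus
      using c by algebra
    then show "p \<in> curve (line_form (erot (- \<theta>) x))"
      unfolding zw(4) qrot_hpt using nz zw(3) by (simp add: mem_curve flip: z'_def w'_def)
  qed
  have "p \<in> qrot \<theta> ` curve (line_form x)" if "p \<in> curve (line_form (erot (- \<theta>) x))" for p
  proof
    show "p = qrot \<theta> (qrot (- \<theta>) p)" by (simp add: qrot_qrot)
    have "qrot (- \<theta>) p \<in> curve (line_form (erot (- (- \<theta>)) (erot (- \<theta>) x)))" using sub that by blast
    then show "qrot (- \<theta>) p \<in> curve (line_form x)" by (simp add: erot_erot)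
  qed
  then show ?thesis using sub by blast
qed

lemma Rot_funpow_curve_line_form: "(Rot n ^^ k) ` curve (line_form x) = curve (line_form ((hyp_rot n ^^ k) x))"
  using qrot_curve_line_form by (simp add: hyp_rot_funpow Rot_funpow[abs_def])

section \<open>The induced real structure\<close>

text \<open>Exchanging the factors reverses the angle and conjugation reverses it again. This is why
  \<sigma> descends to the quotient.\<close>

lemma sigma_qrot: "sigma (qrot \<theta> x) = qrot \<theta> (sigma x)"
proof -
  have "(\<chi> i. cnj (vector [cis \<phi> * z $ 1, z $ 2] $ i)) = (vector [cis (- \<phi>) * cnj (z $ 1), cnj (z $ 2)] :: complex^2)" for \<phi> and z :: "complex^2"
    by (simp add: vec2_eq_iff cis_cnj)
  then show ?thesis by (simp add: sigma_def qrot_def image_image)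
qed

lemma sigma_sigma: "sigma (sigma x) = x"
  by (simp add: sigma_def image_image)

lemma cnj_image_hpt: "(\<lambda>z. \<chi> i. cnj (z $ i)) ` hpt z = hpt (\<chi> i. cnj (z $ i))"
proof -
  have *: "(\<chi> i. cnj ((d *s z) $ i)) = cnj d *s (\<chi> i. cnj (z $ i))" for d
    by (simp add: vec2_eq_iff)
  have "cnj ` {d. d \<noteq> 0} = {d. d \<noteq> 0}"
    by (auto intro: image_eqI[of _ _ "cnj _"])
  then have "(\<lambda>d. cnj d *s (\<chi> i. cnj (z $ i))) ` {d. d \<noteq> 0} = (\<lambda>d. d *s (\<chi> i. cnj (z $ i))) ` {d. d \<noteq> 0}"
    using image_image[of "\<lambda>d. d *s (\<chi> i. cnj (z $ i))" cnj "{d. d \<noteq> 0}"] by simp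
  then show ?thesis by (simp only: hpt_image image_image *)
qed

text \<open>Exchanging the variables and conjugating keeps b and negates a, which is a half-turn. So
  a line with a \<noteq> 0 is not real on \<open>Q\<close> itself.\<close>

lemma sigma_curve_line_form: "sigma ` curve (line_form x) = curve (line_form (erot pi x))"
proof -
  have sub: "sigma ` curve (line_form x) \<subseteq> curve (line_form (erot pi x))" for x
  proof
    fix p assume "p \<in> sigma ` curve (line_form x)"
    then obtain z w where zw: "z \<noteq> 0" "w \<noteq> 0" "ev (line_form x) z w = 0" "p = sigma (hpt z, hpt w)"
      by (auto simp: curve_def)
    define z' :: "complex^2" where "z' = (\<chi> i. cnj (z $ i))"
    define w' :: "complex^2" where "w' = (\<chi> i. cnj (w $ i))"
    have nz: "z' \<noteq> 0" "w' \<noteq> 0" using zw by (auto simp: z'_def w'_def vec2_eq_iff)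
    have "ev (line_form (erot pi x)) w' z' = cnj (ev (line_form x) z w)"
      by (simp add: ev_line_form erot_def z'_def w'_def algebra_simps)
    then show "p \<in> curve (line_form (erot pi x))"
      unfolding zw(4) sigma_def fst_conv snd_conv cnj_image_hpt
      using nz zw(3) by (simp add: mem_curve flip: z'_def w'_def)
  qed
  have "p \<in> sigma ` curve (line_form x)" if "p \<in> curve (line_form (erot pi x))" for p
  proof
    show "p = sigma (sigma p)" by (simp add: sigma_sigma)
    have "sigma p \<in> curve (line_form (erot pi (erot pi x)))" using sub that by blast
    then show "sigma p \<in> curve (line_form x)" by (simp add: erot_def)
  qed
  then show ?thesis using sub by blast
qed

lemma real_curve_Phi_line_form:
  assumes "n \<ge> 2" "even n"
  shows "real_curve (Phi n ` curve (line_form x))"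
proof -
  have n: "n > 0" using assms by simp
  have "sigma ((Rot n ^^ k) p) = (Rot n ^^ k) (sigma p)" for k p
    by (simp add: Rot_funpow sigma_qrot)
  then have Phi: "sigma_quot (Phi n p) = Phi n (sigma p)" for p
    by (simp only: sigma_quot_def Phi_def full_SetCompr_eq image_image simp_thms)
  \<comment> \<open>Evenness enters here: \<open>n div 2\<close> steps make exactly a half-turn, and
    the angles pi and -pi agree.\<close>
  have half: "(hyp_rot n ^^ (n div 2)) x = erot pi x"
  proof -
    have "2 * pi * real (n div 2) / real n = pi" using assms by (simp add: real_of_nat_div field_simps)
    then have "(hyp_rot n ^^ (n div 2)) x = erot (- pi) x" by (simp only: hyp_rot_funpow)
    moreover have "cis (- pi) = - 1" by (simp add: complex_eq_iff)
    ultimately show ?thesis by (simp add: erot_def)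
  qed
  have "sigma_quot ` Phi n ` curve (line_form x) = Phi n ` sigma ` curve (line_form x)"
    by (simp add: image_image Phi)
  also have "\<dots> = Phi n ` (Rot n ^^ (n div 2)) ` curve (line_form x)"
    by (simp only: sigma_curve_line_form Rot_funpow_curve_line_form half)
  also have "\<dots> = Phi n ` curve (line_form x)"
  proof -
    have "n div 2 < n" using n by simp
    then have "Phi n p = Phi n ((Rot n ^^ (n div 2)) p)" for p
      using Phi_eq_iff[OF n] by blast
    then show ?thesis by (simp add: image_image)
  qed
  finally show ?thesis by (simp add: real_curve_def)
qed

section \<open>The quotient chart\<close>

text \<open>Substituting the graph of x into the equation of y gives, up to sign, a polynomial P in
  \<zeta> of degree at most two. Infinitely many roots kill it, and its two higher coefficients
  recover a and b. Integer sample points avoid infinity and suit a pigeonhole argument.\<close>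

lemma line_form_eq_of_infinite_intersection:
  assumes "infinite {k :: nat. ev (line_form y) (vector [of_nat k, 1]) (line_map x (vector [of_nat k, 1])) = 0}"
  shows "y = x"
proof -
  define P where "P = [: complex_of_real (snd y) * cnj (fst x) - complex_of_real (snd x) * cnj (fst y),
    complex_of_real (snd y) + fst y * cnj (fst x) - complex_of_real (snd x) - cnj (fst y) * fst x, fst y - fst x :]"
  have "poly P (of_nat k) = - ev (line_form y) (vector [of_nat k, 1]) (line_map x (vector [of_nat k, 1]))" for k :: nat
    by (simp add: P_def ev_line_form_wedge wedge_def line_map_def algebra_simps)
  then have "of_nat ` {k :: nat. ev (line_form y) (vector [of_nat k, 1]) (line_map x (vector [of_nat k, 1])) = 0} \<subseteq> {\<zeta>. poly P \<zeta> = 0}"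
    by auto
  moreover have "infinite (of_nat ` {k :: nat. ev (line_form y) (vector [of_nat k, 1]) (line_map x (vector [of_nat k, 1])) = 0} :: complex set)"
    using assms by (subst finite_image_iff) (auto intro: inj_onI)
  ultimately have "infinite {\<zeta>. poly P \<zeta> = 0}" using infinite_super by blast
  then have "P = 0" using poly_roots_finite by blast
  then have a: "fst y = fst x" and
    b: "complex_of_real (snd y) + fst y * cnj (fst x) - complex_of_real (snd x) - cnj (fst y) * fst x = 0"
    by (simp add: P_def, unfold P_def pCons_eq_0_iff) blast
  have "complex_of_real (snd y) = complex_of_real (snd x)" using b unfolding a by (simp add: mult.commute)
  then show ?thesis using a by (simp add: prod_eq_iff)
qed

lemma erot_paraboloid: "erot \<theta> x \<in> paraboloid \<longleftrightarrow> x \<in> paraboloid"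
  by (simp add: mem_paraboloid height_def erot_def norm_mult)

text \<open>Each sample point on the line of y lies on one of the n rotated copies of the line of x.
  By pigeonhole one copy contains infinitely many of them, and so is the line of y.\<close>

lemma Phi_curve_line_form_eq_iff:
  assumes n: "n > 0" and x: "x \<in> paraboloid" and y: "y \<in> paraboloid"
  shows "Phi n ` curve (line_form x) = Phi n ` curve (line_form y) \<longleftrightarrow> (\<exists>k<n. y = (hyp_rot n ^^ k) x)"
proof
  assume eq: "Phi n ` curve (line_form x) = Phi n ` curve (line_form y)"
  define P where "P j = (vector [of_nat j, 1] :: complex^2)" for j :: nat
  have P: "P j \<noteq> 0" for j by (simp add: P_def vec2_eq_iff)
  have "\<exists>k<n. ev (line_form ((hyp_rot n ^^ k) x)) (P j) (line_map y (P j)) = 0" for j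
  proof -
    have "(hpt (P j), hpt (line_map y (P j))) \<in> curve (line_form y)" using P by (auto simp: curve_line_form[OF y])
    then have "Phi n (hpt (P j), hpt (line_map y (P j))) \<in> Phi n ` curve (line_form x)" using eq by blast
    then obtain p where p: "p \<in> curve (line_form x)" "Phi n p = Phi n (hpt (P j), hpt (line_map y (P j)))" by force
    then obtain k where "k < n" "(hpt (P j), hpt (line_map y (P j))) = (Rot n ^^ k) p"
      using Phi_eq_iff[OF n] by blast
    then have "(hpt (P j), hpt (line_map y (P j))) \<in> curve (line_form ((hyp_rot n ^^ k) x))"
      using p(1) by (simp flip: Rot_funpow_curve_line_form)
    then show ?thesis using \<open>k < n\<close> mem_curve[OF P line_map_nonzero[OF y P]] by blast
  qed
  then obtain \<kappa> where \<kappa>: "\<And>j. \<kappa> j < n" "\<And>j. ev (line_form ((hyp_rot n ^^ \<kappa> j) x)) (P j) (line_map y (P j)) = 0" by metis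
  have "finite (range \<kappa>)" by (rule finite_subset[of _ "{..<n}"]) (use \<kappa>(1) in auto)
  then obtain j0 where "infinite {j. \<kappa> j = \<kappa> j0}"
    using pigeonhole_infinite[of UNIV \<kappa>] by auto
  then have "infinite {j. ev (line_form ((hyp_rot n ^^ \<kappa> j0) x)) (P j) (line_map y (P j)) = 0}"
    by (rule infinite_super[rotated]) (use \<kappa>(2) in auto, metis)
  then have "(hyp_rot n ^^ \<kappa> j0) x = y" unfolding P_def by (rule line_form_eq_of_infinite_intersection)
  then show "\<exists>k<n. y = (hyp_rot n ^^ k) x" using \<kappa>(1) by blast
next
  assume "\<exists>k<n. y = (hyp_rot n ^^ k) x"
  then obtain k where k: "k < n" "y = (hyp_rot n ^^ k) x" by blast
  have "Phi n p = Phi n ((Rot n ^^ k) p)" for p using Phi_eq_iff[OF n] k(1) by blast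
  then show "Phi n ` curve (line_form x) = Phi n ` curve (line_form y)"
    by (simp add: k(2) image_image flip: Rot_funpow_curve_line_form)
qed

section \<open>Rotations as Einstein--Weyl isomorphisms\<close>

lemma bij_erot: "bij (erot \<theta>)"
  by (rule bij_betw_byWitness[of _ "erot (- \<theta>)"]) (auto simp: erot_erot)

lemma bounded_linear_erot: "bounded_linear (erot \<theta>)"
  unfolding linear_conv_bounded_linear[symmetric]
  by (rule linearI) (simp_all add: erot_def scaleR_conv_of_real algebra_simps)

text \<open>A rotation is a linear isometry, so its second derivative drops out. The target
  connection is left variable to cover \<open>levi_civita hyp_metric\<close> as well as
  \<open>hyp_conn\<close>.\<close>

lemma local_EW_iso_erot:
  assumes "\<And>x. x \<in> paraboloid \<Longrightarrow> \<Gamma> x = hyp_conn x"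
  shows "local_EW_iso paraboloid hyp_metric hyp_conn hyp_metric \<Gamma> (erot \<theta>)"
proof -
  have D: "frechet_derivative (erot \<theta>) (at x) = erot \<theta>" for x
    by (rule frechet_derivative_eq, rule bounded_linear_imp_has_derivative, rule bounded_linear_erot)
  have inner: "(cis \<theta> * a) \<bullet> (cis \<theta> * b) = a \<bullet> b" for a b :: complex
  proof -
    have "cos \<theta> * cos \<theta> + sin \<theta> * sin \<theta> = 1"
      using sin_cos_squared_add[of \<theta>] by (simp add: power2_eq_square add.commute)
    then show ?thesis unfolding inner_complex_def times_complex.sel cis.sel by algebra
  qed
  have h: "height (erot \<theta> x) = height x" for x by (simp add: height_def erot_def norm_mult)
  have dh: "dheight (erot \<theta> x) (erot \<theta> v) = dheight x v" for x v by (simp add: dheight_def erot_def inner)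
  have "hyp_metric (erot \<theta> x) (erot \<theta> v) (erot \<theta> w) = 1 * hyp_metric x v w" for x v w
    by (simp add: hyp_metric_eq h dh) (simp add: erot_def inner)
  then have met: "\<exists>c>0. \<forall>v w. hyp_metric (erot \<theta> x) (erot \<theta> v) (erot \<theta> w) = c * hyp_metric x v w" for x
    by (metis zero_less_one)
  have con: "erot \<theta> (hyp_conn x v w) = hyp_conn (erot \<theta> x) (erot \<theta> v) (erot \<theta> w)" for x v w
  proof -
    have lin: "linear (erot \<theta>)" using bounded_linear_erot by (rule bounded_linear.linear)
    show ?thesis unfolding hyp_conn_def h dh by (simp only: linear_cmul[OF lin] linear_add[OF lin])
  qed
  show ?thesis unfolding local_EW_iso_def Let_def D
    using met con bij_erot[of \<theta>] assms erot_paraboloid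
    by (simp add: smooth_map_on_bounded_linear[OF open_paraboloid bounded_linear_erot] frechet_derivative_const)
qed

section \<open>The quotient orbifold\<close>

text \<open>One chart suffices for a global quotient, with all n rotations as its local
  group.\<close>

definition quotient_chart :: "nat \<Rightarrow> qpoint set set ew_chart" where
  "quotient_chart n = \<lparr> ec_dom = paraboloid, ec_grp = {hyp_rot n ^^ k | k. k < n},
    ec_map = (\<lambda>x. Phi n ` curve (line_form x)), ec_met = hyp_metric, ec_conn = hyp_conn \<rparr>"

lemma quotient_chart_sel [simp]:
  "ec_dom (quotient_chart n) = paraboloid" "ec_grp (quotient_chart n) = {hyp_rot n ^^ k | k. k < n}"
  "ec_map (quotient_chart n) = (\<lambda>x. Phi n ` curve (line_form x))" "ec_met (quotient_chart n) = hyp_metric"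
  "ec_conn (quotient_chart n) = hyp_conn"
  by (simp_all add: quotient_chart_def)

lemma hyp_rot_funpow_eq: "hyp_rot n ^^ k = erot (- (2 * pi * real k / real n))"
  by (rule ext) (rule hyp_rot_funpow)

lemma is_ew_chart_quotient_chart:
  assumes n: "n > 0"
  shows "is_ew_chart (quotient_chart n)"
proof -
  define G where "G = {hyp_rot n ^^ k | k. k < n}"
  have mod: "\<exists>\<epsilon>\<in>G. \<forall>x. \<epsilon> x = (hyp_rot n ^^ k) x" for k
  proof
    show "hyp_rot n ^^ (k mod n) \<in> G" using n by (auto simp: G_def)
    show "\<forall>x. (hyp_rot n ^^ (k mod n)) x = (hyp_rot n ^^ k) x"
      using funpow_mod_eq[OF hyp_rot_period[OF n]] by blast
  qed
  have "G = (\<lambda>k. hyp_rot n ^^ k) ` {..<n}" by (auto simp: G_def)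
  then have fin: "finite G" by simp
  have id: "\<exists>\<epsilon>\<in>G. \<forall>x\<in>paraboloid. \<epsilon> x = x"
    using mod[of 0] unfolding funpow.simps id_apply by blast
  have comp: "\<exists>\<epsilon>\<in>G. \<forall>x\<in>paraboloid. \<epsilon> x = \<gamma> (\<delta> x)" if G: "\<gamma> \<in> G" "\<delta> \<in> G" for \<gamma> \<delta>
  proof -
    obtain j k where "\<gamma> = hyp_rot n ^^ j" "\<delta> = hyp_rot n ^^ k" using G unfolding G_def by blast
    then have "\<gamma> (\<delta> x) = (hyp_rot n ^^ (j + k)) x" for x by (simp add: funpow_add)
    then show ?thesis using mod[of "j + k"] by metis
  qed
  have inv: "\<exists>\<delta>\<in>G. \<forall>x\<in>paraboloid. \<delta> (\<gamma> x) = x" if \<gamma>: "\<gamma> \<in> G" for \<gamma>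
  proof -
    obtain k where k: "\<gamma> = hyp_rot n ^^ k" "k < n" using \<gamma> by (auto simp: G_def)
    have "(hyp_rot n ^^ (n - k)) (\<gamma> x) = (hyp_rot n ^^ (n - k + k)) x" for x
      unfolding k(1) funpow_add by simp
    then have "(hyp_rot n ^^ (n - k)) (\<gamma> x) = x" for x using k(2) hyp_rot_period[OF n] by simp
    then show ?thesis using mod[of "n - k"] by metis
  qed
  have iso: "bij_betw \<gamma> paraboloid paraboloid \<and> local_EW_iso paraboloid hyp_metric hyp_conn hyp_metric hyp_conn \<gamma>"
    if \<gamma>: "\<gamma> \<in> G" for \<gamma>
  proof -
    obtain \<theta> where \<theta>: "\<gamma> = erot \<theta>" using \<gamma> by (auto simp: G_def hyp_rot_funpow_eq)
    have "bij_betw (erot \<theta>) paraboloid paraboloid"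
      by (rule bij_betw_byWitness[of _ "erot (- \<theta>)"]) (auto simp: erot_erot erot_paraboloid)
    then show ?thesis unfolding \<theta> using local_EW_iso_erot[of hyp_conn] by simp
  qed
  have fib: "Phi n ` curve (line_form x) = Phi n ` curve (line_form y) \<longleftrightarrow> (\<exists>\<gamma>\<in>G. y = \<gamma> x)"
    if "x \<in> paraboloid" "y \<in> paraboloid" for x y
    unfolding Phi_curve_line_form_eq_iff[OF n that] G_def by blast
  show ?thesis
    unfolding is_ew_chart_def Let_def quotient_chart_sel G_def[symmetric]
  proof (intro conjI)
    show "\<forall>\<gamma>\<in>G. \<forall>\<delta>\<in>G. \<exists>\<epsilon>\<in>G. \<forall>x\<in>paraboloid. \<epsilon> x = \<gamma> (\<delta> x)"
      by (intro ballI comp)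
    show "\<forall>\<gamma>\<in>G. \<exists>\<delta>\<in>G. \<forall>x\<in>paraboloid. \<delta> (\<gamma> x) = x"
      by (intro ballI inv)
    show "\<forall>\<gamma>\<in>G. bij_betw \<gamma> paraboloid paraboloid \<and>
        local_EW_iso paraboloid hyp_metric hyp_conn hyp_metric hyp_conn \<gamma>"
      by (intro ballI iso)
    show "\<forall>x\<in>paraboloid. \<forall>y\<in>paraboloid.
        Phi n ` curve (line_form x) = Phi n ` curve (line_form y) \<longleftrightarrow> (\<exists>\<gamma>\<in>G. y = \<gamma> x)"
      by (intro ballI fib)
  qed (fact open_paraboloid connected_paraboloid paraboloid_nonempty einstein_weyl_hyp fin id)+
qed

text \<open>All lifts are globally defined rotations, so the whole paraboloid serves as
  neighbourhood, both for the compatibility of the chart with itself and for the comparison with the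
  hyperbolic orbifold.\<close>

lemma lifts_at_rotation:
  assumes c: "ec_dom c = paraboloid" "ec_met c = hyp_metric" "ec_conn c = hyp_conn"
    and d: "ec_dom d = paraboloid" "ec_met d = hyp_metric" "\<And>x. x \<in> paraboloid \<Longrightarrow> ec_conn d x = hyp_conn x"
    and x: "x \<in> paraboloid" and "(hyp_rot n ^^ k) x = y"
    and "\<And>v. v \<in> paraboloid \<Longrightarrow> ec_map d ((hyp_rot n ^^ k) v) = h (ec_map c v)"
  shows "lifts_at c d h x y"
  unfolding lifts_at_def c d(1,2)
proof (intro exI conjI)
  show "open paraboloid" by (rule open_paraboloid)
  show "x \<in> paraboloid" by (rule x)
  show "(hyp_rot n ^^ k) ` paraboloid \<subseteq> paraboloid"
    by (auto simp: hyp_rot_funpow_eq erot_paraboloid)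
  show "local_EW_iso paraboloid hyp_metric hyp_conn hyp_metric (ec_conn d) (hyp_rot n ^^ k)"
    unfolding hyp_rot_funpow_eq by (rule local_EW_iso_erot[OF d(3)])
qed (use assms in auto)

section \<open>Topology of the quotient\<close>

lemma openin_orbifold_topology:
  "openin (orbifold_topology X A) W \<longleftrightarrow> W \<subseteq> X \<and> (\<forall>c\<in>A. open {x \<in> ec_dom c. ec_map c x \<in> W})"
  if "\<And>c. c \<in> A \<Longrightarrow> open (ec_dom c)"
proof -
  have "istopology (\<lambda>W. W \<subseteq> X \<and> (\<forall>c\<in>A. open {x \<in> ec_dom c. ec_map c x \<in> W}))"
    unfolding istopology_def
  proof (intro conjI allI impI ballI)
    fix S T c
    assume "S \<subseteq> X \<and> (\<forall>c\<in>A. open {x \<in> ec_dom c. ec_map c x \<in> S})"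
      "T \<subseteq> X \<and> (\<forall>c\<in>A. open {x \<in> ec_dom c. ec_map c x \<in> T})" "c \<in> A"
    then have "open ({x \<in> ec_dom c. ec_map c x \<in> S} \<inter> {x \<in> ec_dom c. ec_map c x \<in> T})" by blast
    also have "{x \<in> ec_dom c. ec_map c x \<in> S} \<inter> {x \<in> ec_dom c. ec_map c x \<in> T} = {x \<in> ec_dom c. ec_map c x \<in> S \<inter> T}"
      by blast
    finally show "open {x \<in> ec_dom c. ec_map c x \<in> S \<inter> T}" .
  next
    fix \<K> c
    assume \<K>: "\<forall>K\<in>\<K>. K \<subseteq> X \<and> (\<forall>c\<in>A. open {x \<in> ec_dom c. ec_map c x \<in> K})" "c \<in> A"
    have "open (\<Union>K\<in>\<K>. {x \<in> ec_dom c. ec_map c x \<in> K})" using \<K> by blast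
    also have "(\<Union>K\<in>\<K>. {x \<in> ec_dom c. ec_map c x \<in> K}) = {x \<in> ec_dom c. ec_map c x \<in> \<Union>\<K>}" by blast
    finally show "open {x \<in> ec_dom c. ec_map c x \<in> \<Union>\<K>}" .
  qed blast+
  then show ?thesis unfolding orbifold_topology_def by (simp add: topology_inverse')
qed

text \<open>\<open>fst x ^ n\<close> and \<open>snd x\<close> are invariants that separate orbits,
  since two n-th roots of the same nonzero number differ by a root of unity.\<close>

lemma hyp_rot_orbit_iff_power:
  assumes n: "n > 0"
  shows "(\<exists>k<n. y = (hyp_rot n ^^ k) x) \<longleftrightarrow> fst x ^ n = fst y ^ n \<and> snd x = snd y"
proof
  assume "\<exists>k<n. y = (hyp_rot n ^^ k) x"
  then obtain k where "y = erot (- (2 * pi * real k / real n)) x" by (auto simp: hyp_rot_funpow)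
  moreover have "cis (- (2 * pi * real k / real n)) ^ n = 1"
  proof -
    have "cis (- (2 * pi * real k / real n)) ^ n = cis (2 * pi * of_int (- int k))"
      unfolding Complex.DeMoivre using n by (simp add: field_simps)
    then show ?thesis by (simp only: cis_multiple_2pi Ints_of_int)
  qed
  ultimately show "fst x ^ n = fst y ^ n \<and> snd x = snd y"
    by (simp add: erot_def power_mult_distrib)
next
  assume *: "fst x ^ n = fst y ^ n \<and> snd x = snd y"
  show "\<exists>k<n. y = (hyp_rot n ^^ k) x"
  proof (cases "fst y = 0")
    case True
    then have "y = (hyp_rot n ^^ 0) x" using * n by (simp add: prod_eq_iff power_0_left)
    then show ?thesis using n by blast
  next
    case False
    then have "(fst x / fst y) ^ n = 1" using * by (simp add: power_divide)
    then obtain k where k: "k < n" "fst x / fst y = cis (2 * pi * real k / real n)"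
      using Complex.bij_betw_roots_unity[OF n] unfolding bij_betw_def by (auto simp: set_eq_iff image_iff)
    have "fst x = cis (2 * pi * real k / real n) * fst y" using k(2) False by (simp add: field_simps)
    then have "x = erot (2 * pi * real k / real n) y" using * by (simp add: erot_def prod_eq_iff)
    then have "y = (hyp_rot n ^^ k) x" by (simp add: hyp_rot_funpow erot_erot)
    then show ?thesis using k(1) by blast
  qed
qed

text \<open>The invariants F induce a continuous injection of the quotient into \<open>E3\<close>,
  which makes it Hausdorff. The projection p is open, so it carries a countable basis to a countable
  basis.\<close>

lemma quotient_chart_topology:
  assumes n: "n > 0"
  defines "X \<equiv> (\<lambda>x. Phi n ` curve (line_form x)) ` paraboloid"
  shows "Hausdorff_space (orbifold_topology X {quotient_chart n})"
    and "second_countable (orbifold_topology X {quotient_chart n})"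
proof -
  define p where "p x = Phi n ` curve (line_form x)" for x
  define T where "T = orbifold_topology X {quotient_chart n}"
  have X: "X = p ` paraboloid" by (simp add: X_def p_def)
  have openT: "openin T W \<longleftrightarrow> W \<subseteq> X \<and> open {x \<in> paraboloid. p x \<in> W}" for W
    unfolding T_def by (subst openin_orbifold_topology) (simp_all add: open_paraboloid p_def)
  have fib: "p x = p y \<longleftrightarrow> (\<exists>k<n. y = (hyp_rot n ^^ k) x)" if "x \<in> paraboloid" "y \<in> paraboloid" for x y
    unfolding p_def by (rule Phi_curve_line_form_eq_iff[OF n that])
  define F :: "E3 \<Rightarrow> E3" where "F x = (fst x ^ n, snd x)" for x
  have F: "p x = p y \<longleftrightarrow> F x = F y" if "x \<in> paraboloid" "y \<in> paraboloid" for x y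
    unfolding fib[OF that] hyp_rot_orbit_iff_power[OF n] by (simp add: F_def)
  define sep where "sep B = p ` {x \<in> paraboloid. F x \<in> B}" for B
  have pre: "{x \<in> paraboloid. p x \<in> sep B} = F -` B \<inter> paraboloid" for B
    unfolding sep_def using F by auto
  have sep: "openin T (sep B)" if "open B" for B
  proof -
    have "open (F -` B)"
      by (intro open_vimage that) (auto simp: F_def[abs_def] intro!: continuous_intros)
    then show ?thesis unfolding openT pre by (auto simp: sep_def X open_paraboloid open_Int)
  qed
  have "topspace T \<subseteq> X" using openT[of "topspace T"] by simp
  then show "Hausdorff_space (orbifold_topology X {quotient_chart n})"
    unfolding T_def[symmetric] Hausdorff_space_def
  proof (intro allI impI, elim conjE)
    fix P P' assume PP: "P \<in> topspace T" "P' \<in> topspace T" "P \<noteq> P'"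
    then obtain x x' where x: "x \<in> paraboloid" "P = p x" "x' \<in> paraboloid" "P' = p x'"
      using \<open>topspace T \<subseteq> X\<close> unfolding X by blast
    then have "F x \<noteq> F x'" using F PP(3) by blast
    then obtain B B' where B: "open B" "open B'" "F x \<in> B" "F x' \<in> B'" "B \<inter> B' = {}"
      using hausdorff by metis
    have "disjnt (sep B) (sep B')"
      using F B(5) unfolding disjnt_def sep_def by auto
    moreover have "P \<in> sep B" "P' \<in> sep B'" using x B by (auto simp: sep_def)
    ultimately show "\<exists>U V. openin T U \<and> openin T V \<and> P \<in> U \<and> P' \<in> V \<and> disjnt U V"
      using sep B by blast
  qed
  obtain \<B> :: "E3 set set" where \<B>: "countable \<B>" "topological_basis \<B>"
    using ex_countable_basis by blast
  have img: "openin T (p ` (B \<inter> paraboloid))" if B: "open B" for B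
  proof -
    \<comment> \<open>The saturation of an open set is a finite union of its rotated copies.\<close>
    have "{x \<in> paraboloid. p x \<in> p ` (B \<inter> paraboloid)} = (\<Union>k<n. (hyp_rot n ^^ k) -` (B \<inter> paraboloid)) \<inter> paraboloid"
    proof (intro equalityI subsetI)
      fix x assume "x \<in> {x \<in> paraboloid. p x \<in> p ` (B \<inter> paraboloid)}"
      then obtain y where y: "x \<in> paraboloid" "p x = p y" "y \<in> B" "y \<in> paraboloid" by blast
      then obtain k where "k < n" "y = (hyp_rot n ^^ k) x" using fib by blast
      then show "x \<in> (\<Union>k<n. (hyp_rot n ^^ k) -` (B \<inter> paraboloid)) \<inter> paraboloid" using y by blast
    next
      fix x assume "x \<in> (\<Union>k<n. (hyp_rot n ^^ k) -` (B \<inter> paraboloid)) \<inter> paraboloid"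
      then obtain k where k: "k < n" "(hyp_rot n ^^ k) x \<in> B \<inter> paraboloid" "x \<in> paraboloid" by blast
      then have "p x = p ((hyp_rot n ^^ k) x)" using fib by blast
      then show "x \<in> {x \<in> paraboloid. p x \<in> p ` (B \<inter> paraboloid)}" using k by blast
    qed
    moreover have "open ((hyp_rot n ^^ k) -` (B \<inter> paraboloid))" for k
      by (intro open_vimage open_Int B open_paraboloid)
        (auto simp: hyp_rot_funpow_eq intro: linear_continuous_on bounded_linear_erot)
    then have "open ((\<Union>k<n. (hyp_rot n ^^ k) -` (B \<inter> paraboloid)) \<inter> paraboloid)"
      by (intro open_Int open_UN open_paraboloid ballI)
    ultimately show ?thesis unfolding openT by (simp only: X) blast
  qed
  show "second_countable (orbifold_topology X {quotient_chart n})"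
    unfolding T_def[symmetric] second_countable_def
  proof (intro exI[of _ "(\<lambda>B. p ` (B \<inter> paraboloid)) ` \<B>"] conjI allI impI ballI)
    show "countable ((\<lambda>B. p ` (B \<inter> paraboloid)) ` \<B>)" using \<B>(1) by simp
    show "openin T V" if "V \<in> (\<lambda>B. p ` (B \<inter> paraboloid)) ` \<B>" for V
      using that img topological_basis_open[OF \<B>(2)] by auto
    fix W P assume WP: "openin T W \<and> P \<in> W"
    then obtain x where x: "x \<in> paraboloid" "P = p x" using openT X by blast
    have *: "open {x \<in> paraboloid. p x \<in> W}" "x \<in> {x \<in> paraboloid. p x \<in> W}" using WP openT x by auto
    obtain B where B: "B \<in> \<B>" "x \<in> B" "B \<subseteq> {x \<in> paraboloid. p x \<in> W}"
      by (rule topological_basisE[OF \<B>(2) *])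
    then show "\<exists>V\<in>(\<lambda>B. p ` (B \<inter> paraboloid)) ` \<B>. P \<in> V \<and> V \<subseteq> W"
      using x by (intro bexI[of _ "p ` (B \<inter> paraboloid)"]) auto
  qed
qed

lemma ew_orbifold_quotient_chart:
  assumes n: "n > 0"
  shows "ew_orbifold ((\<lambda>x. Phi n ` curve (line_form x)) ` paraboloid) {quotient_chart n}"
proof -
  have "lifts_at (quotient_chart n) (quotient_chart n) id x y"
    if x: "x \<in> paraboloid" and y: "y \<in> paraboloid" and eq: "Phi n ` curve (line_form x) = Phi n ` curve (line_form y)" for x y
  proof -
    obtain k where k: "k < n" "y = (hyp_rot n ^^ k) x" using eq Phi_curve_line_form_eq_iff[OF n x y] by blast
    show ?thesis
    proof (rule lifts_at_rotation[where n = n and k = k])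
      fix v assume v: "v \<in> paraboloid"
      have "(hyp_rot n ^^ k) v \<in> paraboloid" using v by (simp add: hyp_rot_funpow_eq erot_paraboloid)
      then show "ec_map (quotient_chart n) ((hyp_rot n ^^ k) v) = id (ec_map (quotient_chart n) v)"
        using Phi_curve_line_form_eq_iff[OF n v] k(1) by (simp, metis)
    qed (use x k in simp_all)
  qed
  then show ?thesis
    unfolding ew_orbifold_def using is_ew_chart_quotient_chart[OF n] quotient_chart_topology[OF n] by simp
qed

lemma ew_orbifold_isomorphic_quotient_chart:
  assumes n: "n > 0"
  shows "ew_orbifold_isomorphic ((\<lambda>x. Phi n ` curve (line_form x)) ` paraboloid) {quotient_chart n} (hyp_orbifold n) (hyp_atlas n)"
proof -
  define p where "p x = Phi n ` curve (line_form x)" for x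
  \<comment> \<open>The parameter chosen by \<open>inv_into\<close> is immaterial because p and
    \<open>hyp_orbit n\<close> have the same fibres on the paraboloid.\<close>
  define h where "h D = hyp_orbit n (inv_into paraboloid p D)" for D
  have eq: "p x = p y \<longleftrightarrow> hyp_orbit n x = hyp_orbit n y" if "x \<in> paraboloid" "y \<in> paraboloid" for x y
    unfolding p_def Phi_curve_line_form_eq_iff[OF n that] hyp_orbit_eq_iff[OF n] ..
  have h: "h (p x) = hyp_orbit n x" if "x \<in> paraboloid" for x
    using that eq[of "inv_into paraboloid p (p x)" x] unfolding h_def
    by (meson f_inv_into_f imageI inv_into_into)
  have "inj_on h (p ` paraboloid)"
    unfolding inj_on_def using h eq by (simp only: ball_simps) (metis imageE)
  moreover have "h ` p ` paraboloid = hyp_orbifold n"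
    unfolding hyp_orbifold_def image_image using h by simp
  ultimately have "bij_betw h (p ` paraboloid) (hyp_orbifold n)" by (simp add: bij_betw_def)
  moreover have "lifts_at (quotient_chart n) d h x y"
    if d: "d \<in> hyp_atlas n" and x: "x \<in> paraboloid" and y: "y \<in> ec_dom d" and hxy: "h (p x) = ec_map d y" for d x y
  proof -
    have d': "ec_dom d = paraboloid" "ec_map d = hyp_orbit n" "ec_met d = hyp_metric" "ec_conn d = levi_civita hyp_metric"
      using d by (simp_all add: hyp_atlas_def)
    have "hyp_orbit n x = hyp_orbit n y" using hxy h[OF x] d' by simp
    then obtain k where k: "k < n" "y = (hyp_rot n ^^ k) x" using hyp_orbit_eq_iff[OF n] by blast
    show ?thesis
    proof (rule lifts_at_rotation[where n = n and k = k])
      fix v assume v: "v \<in> paraboloid"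
      have "hyp_orbit n ((hyp_rot n ^^ k) v) = hyp_orbit n v"
        using hyp_orbit_eq_iff[OF n] k(1) by metis
      then show "ec_map d ((hyp_rot n ^^ k) v) = h (ec_map (quotient_chart n) v)"
        using h[OF v] by (simp add: d' p_def)
    qed (use x k d' levi_civita_hyp_metric in simp_all)
  qed
  ultimately show ?thesis
    unfolding ew_orbifold_isomorphic_def p_def[symmetric] by (intro exI[of _ h]) (simp add: p_def)
qed

theorem proposition2p2:
  fixes n :: nat and X :: "qpoint set set set"
  assumes "n \<ge> 2" and "even n"
    and "X = {Phi n ` curve (form11 a (- cnj a) (complex_of_real b)) | a b. (cmod a)\<^sup>2 + b < 0}"
  shows "(\<forall>D\<in>X. real_curve D) \<and>
    (\<exists>A. determines_EW_orbifold n X A \<and>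
         ew_orbifold_isomorphic X A (hyp_orbifold n) (hyp_atlas n))"
proof -
  have n: "n > 0" using assms(1) by simp
  \<comment> \<open>The parameters of \<open>line_form\<close> are the negatives of those in the
    stated equation.\<close>
  have X: "X = (\<lambda>x. Phi n ` curve (line_form x)) ` paraboloid"
  proof (intro equalityI subsetI)
    fix D assume "D \<in> X"
    then obtain a b where ab: "D = Phi n ` curve (form11 a (- cnj a) (complex_of_real b))" "(cmod a)\<^sup>2 + b < 0"
      using assms(3) by blast
    show "D \<in> (\<lambda>x. Phi n ` curve (line_form x)) ` paraboloid"
      by (rule image_eqI[of _ _ "(- a, - b)"]) (use ab in \<open>simp_all add: line_form_def paraboloid_def\<close>)
  next
    fix D assume "D \<in> (\<lambda>x. Phi n ` curve (line_form x)) ` paraboloid"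
    then obtain a b where ab: "D = Phi n ` curve (line_form (a, b))" "(cmod a)\<^sup>2 < b"
      by (auto simp: paraboloid_def)
    then have "D = Phi n ` curve (form11 (- a) (- cnj (- a)) (complex_of_real (- b))) \<and> (cmod (- a))\<^sup>2 + - b < 0"
      by (simp add: line_form_def)
    then show "D \<in> X" using assms(3) by blast
  qed
  have real: "\<forall>D\<in>X. real_curve D" using X real_curve_Phi_line_form[OF assms(1,2)] by blast
  moreover have "determines_EW_orbifold n X {quotient_chart n}"
    unfolding determines_EW_orbifold_def
    using real ew_orbifold_quotient_chart[OF n] determines_EW_line_form by (auto simp: X intro!: exI[of _ line_form])
  ultimately show ?thesis using ew_orbifold_isomorphic_quotient_chart[OF n] X by blast
qed

end
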